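(* For every integer $d\geqslant 12$ the parity conjecture is false for $\operatorname{Hilb}^d\mathbb{A}^3$; that is, for every integer $d\geqslant 12$ there exists a point $[Z]\in\operatorname{Hilb}^d\mathbb{A}^3$ such that \[ \dim_{\mathbb{C}}\mathsf T_{[Z]}\operatorname{Hilb}^d\mathbb{A}^3\not\equiv d \pmod 2 . \]
   Context: $\operatorname{Hilb}^d X$ is the Hilbert scheme parametrising zero-dimensional closed subschemes of length $d$ of $X$; here $\mathbb{A}^3=\mathbb{A}^3_{\mathbb{C}}$. $\mathsf T_{[Z]}$ denotes the Zariski tangent space; if $Z\subset\mathbb{A}^3$ is defined by an ideal $I\subset R=\mathbb{C}[x,y,z]$, then $\mathsf T_{[Z]}\operatorname{Hilb}^d\mathbb{A}^3\cong\operatorname{Hom}_R(I,R/I)$. The parity conjecture (Okounkov--Pandharipande) for a positive integer $d$ asserts that for every irreducible smooth complex threefold $X$ and every $[Z]\in\operatorname{Hilb}^dX$ one has $\dim_{\mathbb{C}}\mathsf T_{[Z]}\operatorname{Hilb}^dX\equiv d\pmod 2$. *)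

theory Defs
  imports "HOL-Algebra.QuotRing" "Jordan_Normal_Form.VS_Connect"
begin

text \<open>
  The records \<open>('r, 'm) module\<close> extend ring records, so the fields \<open>mult\<close> and \<open>one\<close>
  have to be given below; they play no role for the module structure.
\<close>

definition ideal_module :: "'r ring \<Rightarrow> 'r set \<Rightarrow> ('r, 'r) module" where
  "ideal_module R I =
     \<lparr>carrier = I, monoid.mult = (\<otimes>\<^bsub>R\<^esub>), one = \<one>\<^bsub>R\<^esub>,
      zero = \<zero>\<^bsub>R\<^esub>, add = (\<oplus>\<^bsub>R\<^esub>), smult = (\<otimes>\<^bsub>R\<^esub>)\<rparr>"

definition quotient_module :: "'r ring \<Rightarrow> 'r set \<Rightarrow> ('r, 'r set) module" where
  "quotient_module R I =
     \<lparr>carrier = carrier (R Quot I), monoid.mult = (\<otimes>\<^bsub>R Quot I\<^esub>), one = \<one>\<^bsub>R Quot I\<^esub>,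
      zero = \<zero>\<^bsub>R Quot I\<^esub>, add = (\<oplus>\<^bsub>R Quot I\<^esub>),
      smult = (\<lambda>r X. (I +>\<^bsub>R\<^esub> r) \<otimes>\<^bsub>R Quot I\<^esub> X)\<rparr>"

text \<open>
  \<open>Hom\<^sub>R(M, N)\<close> with its pointwise \<open>R\<close>-module structure. The elements of
  \<^const>\<open>LinearCombinations.module_hom\<close> are constrained on \<open>carrier M\<close> only, so they are
  required to be \<^const>\<open>extensional\<close>: otherwise one homomorphism would be counted many times.
\<close>

definition hom_module ::
  "'r ring \<Rightarrow> ('r, 'm) module \<Rightarrow> ('r, 'n) module \<Rightarrow> ('r, 'm \<Rightarrow> 'n) module" where
  "hom_module R M N =
     \<lparr>carrier = LinearCombinations.module_hom R M N \<inter> extensional (carrier M),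
      monoid.mult = undefined, one = undefined,
      zero = (\<lambda>m\<in>carrier M. \<zero>\<^bsub>N\<^esub>),
      add = (\<lambda>f g. \<lambda>m\<in>carrier M. f m \<oplus>\<^bsub>N\<^esub> g m),
      smult = (\<lambda>r f. \<lambda>m\<in>carrier M. r \<odot>\<^bsub>N\<^esub> f m)\<rparr>"

definition restrict_scalars :: "('k \<Rightarrow> 'r) \<Rightarrow> ('r, 'm) module \<Rightarrow> ('k, 'm) module" where
  "restrict_scalars h M =
     \<lparr>carrier = carrier M, monoid.mult = (\<otimes>\<^bsub>M\<^esub>), one = \<one>\<^bsub>M\<^esub>,
      zero = \<zero>\<^bsub>M\<^esub>, add = (\<oplus>\<^bsub>M\<^esub>), smult = (\<lambda>c m. h c \<odot>\<^bsub>M\<^esub> m)\<rparr>"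

text \<open>
  \<open>\<complex>[x,y,z]\<close> is represented as the iterated polynomial ring \<open>\<complex>[x][y][z]\<close>;
  \<^const>\<open>class_ring\<close> is the carrier-based ring whose operations are those of the type class.
\<close>

abbreviation complex_field :: "complex ring" where
  "complex_field \<equiv> class_ring"

abbreviation coord_ring_A3 :: "complex poly poly poly ring" where
  "coord_ring_A3 \<equiv> class_ring"

definition const_A3 :: "complex \<Rightarrow> complex poly poly poly" where
  "const_A3 c = [:[:[:c:]:]:]"

definition quotient_space_A3 ::
  "complex poly poly poly set \<Rightarrow> (complex, complex poly poly poly set) module" where
  "quotient_space_A3 I = restrict_scalars const_A3 (quotient_module coord_ring_A3 I)"

text \<open>
  Closed points of the Hilbert scheme of \<open>d\<close> points of affine 3-space: a closed subscheme
  \<open>Z\<close> is given by its ideal \<open>I\<close>, and \<open>Z\<close> is zero-dimensional of length \<open>d\<close>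
  iff \<open>dim\<^sub>\<complex> \<complex>[x,y,z]/I = d\<close>. As \<^const>\<open>vectorspace.dim\<close> is only
  meaningful in finite dimension, \<^const>\<open>vectorspace.fin_dim\<close> is demanded as well.
\<close>

definition Hilb_A3 :: "nat \<Rightarrow> complex poly poly poly set set" where
  "Hilb_A3 d =
     {I. ideal I coord_ring_A3 \<and>
         vectorspace.fin_dim complex_field (quotient_space_A3 I) \<and>
         vectorspace.dim complex_field (quotient_space_A3 I) = d}"

text \<open>
  The Zariski tangent space of the Hilbert scheme at \<open>[Z]\<close>, through the identification with
  \<open>Hom\<^sub>R(I, R/I)\<close> for \<open>R = \<complex>[x,y,z]\<close> and \<open>I\<close> the ideal of \<open>Z\<close>.
\<close>

definition tangent_space_Hilb_A3 ::
  "complex poly poly poly set \<Rightarrow>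
     (complex, complex poly poly poly \<Rightarrow> complex poly poly poly set) module" where
  "tangent_space_Hilb_A3 I =
     restrict_scalars const_A3
       (hom_module coord_ring_A3 (ideal_module coord_ring_A3 I) (quotient_module coord_ring_A3 I))"


subsection \<open>The records above are modules and vector spaces\<close>

lemma module_ideal_module:
  assumes "cring R" and "ideal I R"
  shows "module R (ideal_module R I)"
proof -
  interpret cring R by fact
  interpret ideal I R by fact
  show ?thesis
    by (rule module_criteria)
       (use assms(1) in \<open>auto simp: ideal_module_def I_l_closed r_neg l_distr r_distr m_assoc
          a_ac a_Hcarr intro!: bexI[of _ "\<ominus>\<^bsub>R\<^esub> _"]\<close>)
qed

lemma module_quotient_module:
  assumes "cring R" and "ideal I R"
  shows "module R (quotient_module R I)"
proof -
  interpret R: cring R by fact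
  interpret ideal I R by fact
  interpret Q: cring "R Quot I" by (rule quotient_is_cring) fact
  have hom: "(+>\<^bsub>R\<^esub>) I \<in> Ring.ring_hom R (R Quot I)" by (rule rcos_ring_hom)
  note h = ring_hom_closed[OF hom] ring_hom_mult[OF hom] ring_hom_add[OF hom] ring_hom_one[OF hom]
  have "\<forall>v\<in>carrier (R Quot I). \<exists>w\<in>carrier (R Quot I). v \<oplus>\<^bsub>R Quot I\<^esub> w = \<zero>\<^bsub>R Quot I\<^esub>"
    using Q.a_inv_closed Q.r_neg by blast
  then show ?thesis
    by (intro module_criteria)
       (use assms(1) in \<open>auto simp: quotient_module_def h Q.l_distr Q.r_distr Q.m_assoc
          Q.a_ac\<close>)
qed

lemma module_hom_module:
  assumes "cring R" and "module R M" and "module R N"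
  shows "module R (hom_module R M N)"
proof -
  interpret R: cring R by fact
  interpret M: Module.module R M by fact
  interpret N: Module.module R N by fact
  show ?thesis
  proof (rule module_criteria, goal_cases)
    case 4
    show ?case
    proof
      fix f assume "f \<in> carrier (hom_module R M N)"
      then have f: "f \<in> LinearCombinations.module_hom R M N" by (simp add: hom_module_def)
      then have fc: "m \<in> carrier M \<Longrightarrow> f m \<in> carrier N" for m
        by (auto simp: LinearCombinations.module_hom_def)
      let ?g = "\<lambda>m\<in>carrier M. \<ominus>\<^bsub>N\<^esub> f m"
      have "?g \<in> carrier (hom_module R M N)"
        using f by (auto simp: hom_module_def LinearCombinations.module_hom_def
          fc N.minus_add N.smult_r_minus)
      moreover have "f \<oplus>\<^bsub>hom_module R M N\<^esub> ?g = \<zero>\<^bsub>hom_module R M N\<^esub>"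
        by (auto simp: hom_module_def fc N.r_neg)
      ultimately show "\<exists>g\<in>carrier (hom_module R M N).
          f \<oplus>\<^bsub>hom_module R M N\<^esub> g = \<zero>\<^bsub>hom_module R M N\<^esub>" by blast
    qed
  next
    case 5
    have "r \<odot>\<^bsub>N\<^esub> (s \<odot>\<^bsub>N\<^esub> v) = s \<odot>\<^bsub>N\<^esub> (r \<odot>\<^bsub>N\<^esub> v)"
      if "r \<in> carrier R" "s \<in> carrier R" "v \<in> carrier N" for r s v
      using that N.smult_assoc1[of r s v] N.smult_assoc1[of s r v] by (simp add: R.m_comm)
    then show ?case
      by (auto simp: hom_module_def LinearCombinations.module_hom_def N.smult_r_distr Pi_iff)
  next
    case 2
    show ?case
      by (auto simp: hom_module_def LinearCombinations.module_hom_def N.smult_r_distr Pi_iff N.a_ac)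
  next
    case 8
    show ?case
      by (auto simp: hom_module_def LinearCombinations.module_hom_def Pi_iff
          intro!: extensionalityI[of _ "carrier M"])
  next
    case 10
    show ?case
      by (auto simp: hom_module_def LinearCombinations.module_hom_def Pi_iff
          intro!: extensionalityI[of _ "carrier M"])
  qed (use assms(1) in \<open>auto simp: hom_module_def LinearCombinations.module_hom_def Pi_iff
         N.a_ac N.smult_r_distr N.smult_l_distr N.smult_assoc1 fun_eq_iff\<close>)
qed

lemma module_restrict_scalars:
  assumes "module R M" and "cring K" and "h \<in> Ring.ring_hom K R"
  shows "module K (restrict_scalars h M)"
proof -
  interpret Module.module R M by fact
  note h = ring_hom_closed[OF assms(3)] ring_hom_mult[OF assms(3)] ring_hom_add[OF assms(3)]
    ring_hom_one[OF assms(3)]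
  have "\<forall>v\<in>carrier M. \<exists>w\<in>carrier M. v \<oplus>\<^bsub>M\<^esub> w = \<zero>\<^bsub>M\<^esub>"
    using M.a_inv_closed M.r_neg by blast
  then show ?thesis
    by (intro module_criteria)
       (use assms(2) in \<open>auto simp: restrict_scalars_def h M.a_ac smult_r_distr smult_l_distr
          smult_assoc1\<close>)
qed

lemma const_A3_ring_hom: "const_A3 \<in> Ring.ring_hom complex_field coord_ring_A3"
  by (auto simp: Ring.ring_hom_def class_ring_simps const_A3_def one_pCons)

lemma cring_class_ring: "cring (class_ring :: 'a :: comm_ring_1 ring)"
  by (rule class_cring.cring_axioms)

lemma vectorspace_quotient_space_A3:
  assumes "ideal I coord_ring_A3"
  shows "vectorspace complex_field (quotient_space_A3 I)"
  unfolding vectorspace_def quotient_space_A3_def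
  by (intro conjI module_restrict_scalars[OF _ _ const_A3_ring_hom] module_quotient_module
    cring_class_ring assms class_field.field_axioms)

lemma vectorspace_tangent_space_Hilb_A3:
  assumes "ideal I coord_ring_A3"
  shows "vectorspace complex_field (tangent_space_Hilb_A3 I)"
  unfolding vectorspace_def tangent_space_Hilb_A3_def
  by (intro conjI module_restrict_scalars[OF _ _ const_A3_ring_hom] module_hom_module
    module_quotient_module module_ideal_module cring_class_ring assms class_field.field_axioms)

end

theory Submission
  imports Defs
begin

text \<open>
  Let \<open>I = (x + (y, z)\<^sup>2)\<^sup>2 + (y\<^sup>3 - xz)\<close>, which has colength \<open>12\<close>. It is homogeneous for the weights
  \<open>2, 1, 1\<close> of \<open>x, y, z\<close>, and \<open>R/I\<close> lives in weights \<open>0, \<dots>, 3\<close>, with dimensions \<open>1, 2, 4, 5\<close>.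
  Homomorphisms \<open>I \<rightarrow> R/I\<close> of degree \<open>0\<close>, \<open>-1\<close> and \<open>-2\<close> form spaces of dimension \<open>5\<close>, \<open>39\<close> and \<open>1\<close>
  (the last one spanned by \<open>\<partial>/\<partial>x\<close>), and the syzygies of the generators exclude every other degree. So
  the tangent space has dimension \<open>45\<close>, whereas \<open>12\<close> is even. Adding \<open>n = d - 12\<close> reduced points
  \<open>(k, 0, 0)\<close>, \<open>k = 1, \<dots>, n\<close>, raises the length by \<open>n\<close> and the tangent dimension by \<open>3n\<close>, which
  leaves the parity of the difference unchanged.
\<close>


subsection \<open>Dimensions of quotients and of tangent spaces\<close>

text \<open>By \<open>cong\<close>, \<open>P\<close> depends only on the values on \<open>S\<close>,
  so it is a linear map from C^S, which \<open>inj\<close> and \<open>surj\<close> make an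
  isomorphism. A bijection of \<open>S\<close> with an initial segment of the naturals moves it to
  the coordinate space \<open>N.V\<close>.\<close>

lemma vectorspace_dim_parametrization:
  fixes P :: "('s \<Rightarrow> complex) \<Rightarrow> 'v" and V :: "(complex, 'v) module"
  assumes V: "vectorspace complex_field V" and S: "finite S"
    and carr: "\<And>p. P p \<in> carrier V"
    and cong: "\<And>p q. (\<And>s. s \<in> S \<Longrightarrow> p s = q s) \<Longrightarrow> P p = P q"
    and add: "\<And>p q. P (\<lambda>s. p s + q s) = P p \<oplus>\<^bsub>V\<^esub> P q"
    and smult: "\<And>c p. P (\<lambda>s. c * p s) = c \<odot>\<^bsub>V\<^esub> P p"
    and inj: "\<And>p s. P p = \<zero>\<^bsub>V\<^esub> \<Longrightarrow> s \<in> S \<Longrightarrow> p s = 0"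
    and surj: "\<And>v. v \<in> carrier V \<Longrightarrow> \<exists>p. v = P p"
  shows "vectorspace.fin_dim complex_field V \<and> vectorspace.dim complex_field V = card S"
proof -
  obtain h where h: "bij_betw h S {..<card S}"
    using finite_same_card_bij[OF S, of "{..<card S}"] by auto
  define n where "n = card S"
  have hn: "h s < n" if "s \<in> S" for s
    using h that by (auto simp: bij_betw_def n_def)
  define T where "T = (\<lambda>v :: complex vec. P (\<lambda>s. v $ h s))"
  interpret N: vec_space "TYPE(complex)" n .
  interpret V: vectorspace complex_field V by fact
  have N: "vectorspace complex_field N.V" by (rule vec_vs)
  have "mod_hom complex_field N.V V T"
  proof (unfold mod_hom_def mod_hom_axioms_def, intro conjI)
    show "T \<in> LinearCombinations.module_hom complex_field N.V V"
      unfolding LinearCombinations.module_hom_def T_def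
      by (auto simp: carr module_vec_simps add[symmetric] smult[symmetric] hn intro!: cong)
  qed (use N V in \<open>auto simp: vectorspace_def\<close>)
  then interpret T: linear_map complex_field N.V V T
    using N V by (simp add: linear_map_def)
  have ker: "v = 0\<^sub>v n" if v: "v \<in> carrier_vec n" "T v = \<zero>\<^bsub>V\<^esub>" for v
  proof (rule eq_vecI)
    fix i assume "i < dim_vec (0\<^sub>v n :: complex vec)"
    then obtain s where "s \<in> S" "i = h s" using h by (auto simp: bij_betw_def n_def)
    then show "v $ i = 0\<^sub>v n $ i" using inj[of "\<lambda>s. v $ h s" s] v hn by (auto simp: T_def)
  qed (use v in auto)
  have "carrier (N.vs T.kerT) = {\<zero>\<^bsub>N.V\<^esub>}"
    using ker T.f0_is_0 by (auto simp: T.ker_def module_vec_simps)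
  then have inj: "inj_on T (carrier N.V)" by (rule T.Ke0_imp_inj)
  have "v \<in> T ` carrier N.V" if v: "v \<in> carrier V" for v
  proof -
    obtain p where p: "v = P p" using surj[OF v] by blast
    have "v = T (vec n (\<lambda>i. p (inv_into S h i)))" unfolding T_def p
      using h hn by (intro cong) (auto simp: bij_betw_def)
    then show ?thesis by (auto simp: module_vec_simps)
  qed
  then have surj: "T ` carrier N.V = carrier V" using carr by (auto simp: T_def)
  from T.surj_fin_dim[OF N.fin_dim surj] T.dim_eq[OF N.fin_dim inj surj] N.dim_is_n
  show ?thesis by (simp add: n_def)
qed

lemma ideal_class_ringI:
  fixes I :: "'a :: comm_ring_1 set"
  assumes "0 \<in> I" "\<And>a b. a \<in> I \<Longrightarrow> b \<in> I \<Longrightarrow> a + b \<in> I" "\<And>r a. a \<in> I \<Longrightarrow> r * a \<in> I"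
  shows "ideal I class_ring"
proof (rule idealI)
  show "subgroup I (add_monoid class_ring)"
  proof (rule group.subgroupI)
    show "Group.group (add_monoid (class_ring :: 'a ring))"
      using abelian_group.a_group[OF class_ring.abelian_group_axioms] by simp
    fix a assume "a \<in> I"
    then have "- 1 * a \<in> I" by (rule assms(3))
    moreover have "inv\<^bsub>add_monoid class_ring\<^esub> a = - a"
      using class_ring_simps(8) by (metis a_inv_def)
    ultimately show "inv\<^bsub>add_monoid class_ring\<^esub> a \<in> I" by simp
  qed (use assms in auto)
qed (use assms in \<open>auto simp: class_ring.ring_axioms mult.commute\<close>)

text \<open>
  A map satisfying the following predicate represents an element of \<open>Hom\<^sub>R(I, R/I)\<close>.
\<close>

definition hom_mod :: "complex poly poly poly set \<Rightarrow>
    (complex poly poly poly \<Rightarrow> complex poly poly poly) \<Rightarrow> bool" where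
  "hom_mod I g \<longleftrightarrow> (\<forall>a\<in>I. \<forall>b\<in>I. g (a + b) - (g a + g b) \<in> I) \<and>
     (\<forall>r. \<forall>a\<in>I. g (r * a) - r * g a \<in> I)"

section \<open>Homomorphisms into R/I through representatives\<close>

context
  fixes I :: "complex poly poly poly set"
  assumes I: "ideal I coord_ring_A3"
begin

lemma ideal_zero: "0 \<in> I"
  and ideal_add: "a \<in> I \<Longrightarrow> b \<in> I \<Longrightarrow> a + b \<in> I"
  and ideal_mult: "a \<in> I \<Longrightarrow> r * a \<in> I"
  using additive_subgroup.zero_closed[OF ideal.axioms(1)[OF I]]
    additive_subgroup.a_closed[OF ideal.axioms(1)[OF I], of a b]
    ideal.I_l_closed[OF I, of a r] by auto

lemma ideal_diff: "a \<in> I \<Longrightarrow> b \<in> I \<Longrightarrow> a - b \<in> I"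
  using ideal_add[of a "- 1 * b"] ideal_mult[of b "- 1"] by simp

lemma ideal_sum: "(\<And>s. s \<in> S \<Longrightarrow> h s \<in> I) \<Longrightarrow> sum h S \<in> I"
  by (induction S rule: infinite_finite_induct) (auto simp: ideal_zero ideal_add)

lemma hom_mod_zero: "hom_mod I (\<lambda>_. 0)"
  by (simp add: hom_mod_def ideal_zero)

lemma hom_mod_add:
  assumes "hom_mod I g" "hom_mod I h"
  shows "hom_mod I (\<lambda>j. g j + h j)"
proof -
  have eq: "g (a + b) + h (a + b) - (g a + h a + (g b + h b)) =
      (g (a + b) - (g a + g b)) + (h (a + b) - (h a + h b))"
    "g (r * a) + h (r * a) - r * (g a + h a) = (g (r * a) - r * g a) + (h (r * a) - r * h a)" for a b r
    by (simp_all add: algebra_simps)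
  show ?thesis using assms unfolding hom_mod_def eq by (auto intro: ideal_add)
qed

lemma hom_mod_mult:
  assumes "hom_mod I g"
  shows "hom_mod I (\<lambda>j. c * g j)"
proof -
  have eq: "c * g (a + b) - (c * g a + c * g b) = c * (g (a + b) - (g a + g b))"
    "c * g (r * a) - r * (c * g a) = c * (g (r * a) - r * g a)" for a b r
    by (simp_all add: algebra_simps)
  show ?thesis using assms unfolding hom_mod_def eq by (auto intro: ideal_mult)
qed

lemma hom_mod_sum: "(\<And>s. s \<in> S \<Longrightarrow> hom_mod I (h s)) \<Longrightarrow> hom_mod I (\<lambda>j. \<Sum>s\<in>S. h s j)"
  by (induction S rule: infinite_finite_induct) (auto simp: hom_mod_zero hom_mod_add)

lemma hom_mod_diff:
  assumes "hom_mod I g" "hom_mod I h"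
  shows "hom_mod I (\<lambda>j. g j - h j)"
  using hom_mod_add[OF assms(1) hom_mod_mult[OF assms(2), of "- 1"]] by simp

text \<open>With the next two lemmas: the elements of \<open>I\<close> that \<open>g\<close> sends
  into \<open>I\<close> form an ideal, so a homomorphism that vanishes on generators vanishes
  everywhere.\<close>

lemma hom_mod_kernel_add:
  assumes "hom_mod I g" "a \<in> I" "b \<in> I" "g a \<in> I" "g b \<in> I"
  shows "g (a + b) \<in> I"
proof -
  have "(g (a + b) - (g a + g b)) + (g a + g b) \<in> I"
    using assms by (intro ideal_add[of "g (a + b) - (g a + g b)"] ideal_add[of "g a"]) (auto simp: hom_mod_def)
  then show ?thesis by simp
qed

lemma hom_mod_kernel_mult:
  assumes "hom_mod I g" "a \<in> I" "g a \<in> I"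
  shows "g (r * a) \<in> I"
proof -
  have "(g (r * a) - r * g a) + r * g a \<in> I"
    using assms by (intro ideal_add[of "g (r * a) - r * g a"] ideal_mult) (auto simp: hom_mod_def)
  then show ?thesis by simp
qed

lemma hom_mod_kernel_zero: "hom_mod I g \<Longrightarrow> g 0 \<in> I"
  using ideal_zero ideal_mult[of "g 0" 0] unfolding hom_mod_def
  by (metis diff_zero mult_zero_left)

section \<open>Cosets, and bases of the quotient and of the tangent space\<close>

abbreviation (input) cls :: "complex poly poly poly \<Rightarrow> complex poly poly poly set" where
  "cls r \<equiv> I +>\<^bsub>coord_ring_A3\<^esub> r"

lemma cls_hom: "cls \<in> Ring.ring_hom coord_ring_A3 (coord_ring_A3 Quot I)"
  by (rule ideal.rcos_ring_hom[OF I])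

lemma cls_add: "cls r \<oplus>\<^bsub>coord_ring_A3 Quot I\<^esub> cls s = cls (r + s)"
  and cls_mult: "cls r \<otimes>\<^bsub>coord_ring_A3 Quot I\<^esub> cls s = cls (r * s)"
  using ring_hom_add[OF cls_hom, of r s] ring_hom_mult[OF cls_hom, of r s] by auto

lemma cls_eq_iff: "cls r = cls s \<longleftrightarrow> r - s \<in> I"
proof
  assume "cls r = cls s"
  moreover have "r \<in> cls r" using ideal_zero by (force simp: a_r_coset_def' class_ring_simps)
  ultimately obtain i where "i \<in> I" "r = i + s" by (auto simp: a_r_coset_def')
  then show "r - s \<in> I" by simp
next
  assume rs: "r - s \<in> I"
  have "i + r \<in> cls s" if "i \<in> I" for i
    using ideal_add[OF that rs] by (auto simp: a_r_coset_def' intro!: bexI[of _ "i + (r - s)"])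
  moreover have "i + s \<in> cls r" if "i \<in> I" for i
    using ideal_diff[OF that rs] by (auto simp: a_r_coset_def' intro!: bexI[of _ "i - (r - s)"])
  ultimately show "cls r = cls s" by (auto simp: a_r_coset_def')
qed

lemma cls_zero: "\<zero>\<^bsub>coord_ring_A3 Quot I\<^esub> = cls 0"
  using ring_hom_zero[OF cls_hom class_ring.ring_axioms ideal.quotient_is_ring[OF I]] by simp

lemma cls_carrier: "carrier (coord_ring_A3 Quot I) = range cls"
  by (auto simp: FactRing_def A_RCOSETS_def')

lemma dim_quotient_space_A3:
  fixes B :: "'s \<Rightarrow> complex poly poly poly"
  assumes S: "finite S"
    and span: "\<And>r. \<exists>p. r - (\<Sum>s\<in>S. const_A3 (p s) * B s) \<in> I"
    and indep: "\<And>p s. (\<Sum>s\<in>S. const_A3 (p s) * B s) \<in> I \<Longrightarrow> s \<in> S \<Longrightarrow> p s = 0"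
  shows "vectorspace.fin_dim complex_field (quotient_space_A3 I) \<and>
    vectorspace.dim complex_field (quotient_space_A3 I) = card S"
proof (rule vectorspace_dim_parametrization[where P = "\<lambda>p. cls (\<Sum>s\<in>S. const_A3 (p s) * B s)"])
  show "vectorspace complex_field (quotient_space_A3 I)"
    by (rule vectorspace_quotient_space_A3[OF I])
next
  fix v assume "v \<in> carrier (quotient_space_A3 I)"
  then obtain r where r: "v = cls r"
    by (auto simp: quotient_space_A3_def restrict_scalars_def quotient_module_def cls_carrier)
  then show "\<exists>p. v = cls (\<Sum>s\<in>S. const_A3 (p s) * B s)"
    using span[of r] by (auto simp: cls_eq_iff)
next
  fix p s assume "cls (\<Sum>s\<in>S. const_A3 (p s) * B s) = \<zero>\<^bsub>quotient_space_A3 I\<^esub>" "s \<in> S"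
  then show "p s = 0"
    using indep[of p s]
    by (simp add: quotient_space_A3_def restrict_scalars_def quotient_module_def cls_zero cls_eq_iff)
next
  fix c p
  have "(\<Sum>s\<in>S. const_A3 (c * p s) * B s) = const_A3 c * (\<Sum>s\<in>S. const_A3 (p s) * B s)"
    using ring_hom_mult[OF const_A3_ring_hom] by (simp add: sum_distrib_left mult.assoc)
  then show "cls (\<Sum>s\<in>S. const_A3 (c * p s) * B s) =
      c \<odot>\<^bsub>quotient_space_A3 I\<^esub> cls (\<Sum>s\<in>S. const_A3 (p s) * B s)"
    by (simp add: quotient_space_A3_def restrict_scalars_def quotient_module_def cls_mult)
qed (use ring_hom_add[OF const_A3_ring_hom] in \<open>auto simp: S quotient_space_A3_def
      restrict_scalars_def quotient_module_def cls_carrier cls_add distrib_right sum.distrib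
      intro!: arg_cong[of _ _ cls] sum.cong\<close>)


lemma dim_tangent_space_Hilb_A3:
  fixes D :: "'s \<Rightarrow> complex poly poly poly \<Rightarrow> complex poly poly poly"
  assumes S: "finite S"
    and hom: "\<And>s. s \<in> S \<Longrightarrow> hom_mod I (D s)"
    and span: "\<And>g. hom_mod I g \<Longrightarrow> \<exists>p. \<forall>j\<in>I. g j - (\<Sum>s\<in>S. const_A3 (p s) * D s j) \<in> I"
    and indep: "\<And>p s. (\<And>j. j \<in> I \<Longrightarrow> (\<Sum>s\<in>S. const_A3 (p s) * D s j) \<in> I) \<Longrightarrow> s \<in> S \<Longrightarrow> p s = 0"
  shows "vectorspace.fin_dim complex_field (tangent_space_Hilb_A3 I) \<and>
    vectorspace.dim complex_field (tangent_space_Hilb_A3 I) = card S"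
proof -
  define F where "F = (\<lambda>p j. \<Sum>s\<in>S. const_A3 (p s) * D s j)"
  define P where "P = (\<lambda>p. \<lambda>j\<in>I. cls (F p j))"
  note ops = tangent_space_Hilb_A3_def restrict_scalars_def hom_module_def ideal_module_def
    quotient_module_def
  have F_hom: "hom_mod I (F p)" for p
    unfolding F_def by (intro hom_mod_sum hom_mod_mult hom)
  have carrier: "carrier (tangent_space_Hilb_A3 I) =
      {f \<in> extensional I. \<exists>g. hom_mod I g \<and> (\<forall>j\<in>I. f j = cls (g j))}" (is "_ = ?C")
  proof (intro subset_antisym subsetI)
    fix f assume f: "f \<in> carrier (tangent_space_Hilb_A3 I)"
    \<comment> \<open>Representatives are chosen separately for each \<open>j\<close>, so
      \<open>g\<close> is linear only modulo \<open>I\<close>; \<open>hom_mod\<close> asks for no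
      more.\<close>
    define g where "g = (\<lambda>j. SOME r. f j = cls r)"
    have fg: "f j = cls (g j)" if "j \<in> I" for j
    proof -
      have "f j \<in> range cls"
        using f that by (auto simp: ops LinearCombinations.module_hom_def cls_carrier)
      then have "\<exists>r. f j = cls r" by blast
      then show ?thesis unfolding g_def by (rule someI_ex)
    qed
    have "hom_mod I g" unfolding hom_mod_def
    proof (intro conjI ballI allI)
      fix a b assume ab: "a \<in> I" "b \<in> I"
      then have "f (a + b) = f a \<oplus>\<^bsub>coord_ring_A3 Quot I\<^esub> f b"
        using f by (auto simp: ops LinearCombinations.module_hom_def)
      then show "g (a + b) - (g a + g b) \<in> I"
        using ab by (simp add: fg cls_add ideal_add cls_eq_iff)
    next
      fix r a assume a: "a \<in> I"
      then have "f (r * a) = cls r \<otimes>\<^bsub>coord_ring_A3 Quot I\<^esub> f a"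
        using f by (auto simp: ops LinearCombinations.module_hom_def)
      then show "g (r * a) - r * g a \<in> I"
        using a by (simp add: fg cls_mult ideal_mult cls_eq_iff)
    qed
    with f fg show "f \<in> ?C" by (auto simp: ops)
  next
    fix f assume "f \<in> ?C"
    then obtain g where f: "f \<in> extensional I" and g: "hom_mod I g" and fg: "\<forall>j\<in>I. f j = cls (g j)"
      by blast
    then show "f \<in> carrier (tangent_space_Hilb_A3 I)"
      by (auto simp: ops LinearCombinations.module_hom_def cls_carrier cls_add cls_mult cls_eq_iff
          ideal_add ideal_mult hom_mod_def)
  qed
  show ?thesis
  proof (rule vectorspace_dim_parametrization[where P = P, OF _ S])
    show "vectorspace complex_field (tangent_space_Hilb_A3 I)"
      by (rule vectorspace_tangent_space_Hilb_A3[OF I])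
    show "P p \<in> carrier (tangent_space_Hilb_A3 I)" for p
      using F_hom[of p] by (auto simp: carrier P_def)
    show "P p = P q" if "\<And>s. s \<in> S \<Longrightarrow> p s = q s" for p q
      using that by (auto simp: P_def F_def)
    show "P (\<lambda>s. p s + q s) = P p \<oplus>\<^bsub>tangent_space_Hilb_A3 I\<^esub> P q" for p q
      using ring_hom_add[OF const_A3_ring_hom]
      by (auto simp: P_def F_def ops cls_add distrib_right sum.distrib restrict_def fun_eq_iff)
    show "P (\<lambda>s. c * p s) = c \<odot>\<^bsub>tangent_space_Hilb_A3 I\<^esub> P p" for c p
      using ring_hom_mult[OF const_A3_ring_hom]
      by (auto simp: P_def F_def ops cls_mult sum_distrib_left mult.assoc restrict_def fun_eq_iff)
    show "p s = 0" if "P p = \<zero>\<^bsub>tangent_space_Hilb_A3 I\<^esub>" "s \<in> S" for p s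
    proof (rule indep[OF _ that(2)])
      fix j assume "j \<in> I"
      then have "cls (F p j) = cls 0"
        using fun_cong[OF that(1), of j] by (simp add: P_def ops cls_zero)
      then show "(\<Sum>s\<in>S. const_A3 (p s) * D s j) \<in> I" by (simp add: cls_eq_iff F_def)
    qed
    show "\<exists>p. v = P p" if vc: "v \<in> carrier (tangent_space_Hilb_A3 I)" for v
    proof -
      obtain g where v: "v \<in> extensional I" "hom_mod I g" "\<forall>j\<in>I. v j = cls (g j)"
        using vc unfolding carrier by blast
      obtain p where "\<forall>j\<in>I. g j - F p j \<in> I" using span[OF v(2)] by (auto simp: F_def)
      then have "v = P p" using v(1,3)
        by (intro extensionalityI[of _ I]) (auto simp: P_def cls_eq_iff)
      then show ?thesis by blast
    qed
  qed
qed

end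


subsection \<open>The ideal supported at the origin\<close>

type_synonym poly3 = "complex poly poly poly"

text \<open>The outermost polynomial variable is z, so the exponent \<open>k\<close> of z is
  resolved first and the exponent \<open>i\<close> of x last.\<close>

definition coeff3 :: "poly3 \<Rightarrow> nat \<Rightarrow> nat \<Rightarrow> nat \<Rightarrow> complex" where
  "coeff3 r i j k = coeff (coeff (coeff r k) j) i"

definition mon :: "complex \<Rightarrow> nat \<Rightarrow> nat \<Rightarrow> nat \<Rightarrow> poly3" where
  "mon c i j k = monom (monom (monom c i) j) k"

lemma poly3_eqI: "(\<And>i j k. coeff3 r i j k = coeff3 s i j k) \<Longrightarrow> r = s"
  by (intro poly_eqI) (simp add: coeff3_def)

lemma coeff3_simps [simp]:
  "coeff3 0 i j k = 0" "coeff3 (r + s) i j k = coeff3 r i j k + coeff3 s i j k" "coeff3 (r - s) i j k = coeff3 r i j k - coeff3 s i j k"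
  "coeff3 (- r) i j k = - coeff3 r i j k"
  "coeff3 (mon c a b d) i j k = (if i = a \<and> j = b \<and> k = d then c else 0)"
  "coeff3 (mon c a b d * r) i j k = (if a \<le> i \<and> b \<le> j \<and> d \<le> k then c * coeff3 r (i - a) (j - b) (k - d) else 0)"
  by (auto simp: coeff3_def mon_def coeff_monom_mult)

lemma coeff3_sum [simp]: "coeff3 (\<Sum>s\<in>S. g s) i j k = (\<Sum>s\<in>S. coeff3 (g s) i j k)"
  by (induction S rule: infinite_finite_induct) auto

lemma const_A3_eq_mon: "const_A3 c = mon c 0 0 0"
  by (simp add: const_A3_def mon_def monom_0)

lemma coeff3_const_A3_mult [simp]: "coeff3 (const_A3 c * r) i j k = c * coeff3 r i j k"
  by (simp add: const_A3_eq_mon)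

lemma mon_mult: "mon c i j k * mon d a b e = mon (c * d) (i + a) (j + b) (k + e)"
  by (simp add: mon_def mult_monom)

text \<open>The premise on monomials concerns only the terms of this \<open>r\<close>, so that known
  vanishing of its coefficients can be used.\<close>

lemma mon_induct:
  assumes add: "\<And>a b. Q a \<Longrightarrow> Q b \<Longrightarrow> Q (a + b)"
    and mon: "\<And>i j k. Q (mon (coeff3 r i j k) i j k)"
  shows "Q r"
proof -
  \<comment> \<open>Beyond the degree the coefficient is 0, so the premise on monomials already
    covers 0.\<close>
  have 0: "Q 0" using mon[of "Suc (degree (coeff (coeff r 0) 0))" 0 0]
    by (simp add: coeff3_def coeff_eq_0 mon_def)
  have sum: "Q (sum h S)" if "\<And>s. s \<in> S \<Longrightarrow> Q (h s)" for h and S :: "nat set"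
    using that by (induction S rule: infinite_finite_induct) (auto simp: 0 add)
  have "r = (\<Sum>k\<le>degree r. \<Sum>j\<le>degree (coeff r k). \<Sum>i\<le>degree (coeff (coeff r k) j). mon (coeff3 r i j k) i j k)"
    by (simp add: mon_def coeff3_def monom_sum[symmetric] poly_as_sum_of_monoms)
  also have "Q \<dots>" by (intro sum mon)
  finally show ?thesis .
qed

lemma gen_induct:
  assumes const: "\<And>c. Q (const_A3 c)"
    and add: "\<And>a b. Q a \<Longrightarrow> Q b \<Longrightarrow> Q (a + b)"
    and gen: "Q (mon 1 1 0 0)" "Q (mon 1 0 1 0)" "Q (mon 1 0 0 1)"
    and mult: "\<And>a b. Q a \<Longrightarrow> Q b \<Longrightarrow> Q (a * b)"
  shows "Q r"
proof (rule mon_induct)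
  fix i j k
  have pow: "Q (g ^ n)" if "Q g" for g n
    using const[of 1] that by (induction n) (auto simp: mult const_A3_def one_pCons)
  have "mon 1 1 0 0 ^ i = mon 1 i 0 0" "mon 1 0 1 0 ^ j = mon 1 0 j 0" "mon 1 0 0 1 ^ k = mon 1 0 0 k" for i j k
    by (simp_all add: mon_def monom_power)
  with pow[OF gen(1), of i] pow[OF gen(2), of j] pow[OF gen(3), of k]
  have "Q (const_A3 (coeff3 r i j k) * (mon 1 i 0 0 * (mon 1 0 j 0 * mon 1 0 0 k)))"
    by (intro mult const) simp_all
  then show "Q (mon (coeff3 r i j k) i j k)" by (simp add: const_A3_eq_mon mon_mult)
qed (fact add)

text \<open>
  With \<open>x\<close> in weight \<open>2\<close> and \<open>y\<close>, \<open>z\<close> in weight \<open>1\<close>, this is the ideal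
  \<open>(x + (y, z)\<^sup>2)\<^sup>2 + (y\<^sup>3 - xz)\<close>: the span of \<open>y\<^sup>3 - xz\<close> and of all monomials of weight
  at least \<open>4\<close>.
\<close>

definition fat_ideal :: "poly3 set" where
  "fat_ideal = {r. coeff3 r 0 0 0 = 0 \<and> coeff3 r 0 1 0 = 0 \<and> coeff3 r 0 0 1 = 0 \<and>
     coeff3 r 1 0 0 = 0 \<and> coeff3 r 0 2 0 = 0 \<and> coeff3 r 0 1 1 = 0 \<and> coeff3 r 0 0 2 = 0 \<and>
     coeff3 r 1 1 0 = 0 \<and> coeff3 r 0 2 1 = 0 \<and> coeff3 r 0 1 2 = 0 \<and> coeff3 r 0 0 3 = 0 \<and>
     coeff3 r 1 0 1 + coeff3 r 0 3 0 = 0}"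

text \<open>Elements of the ideal have no term of weight below 3, so multiplication by a variable
  yields weight at least 4, where membership is automatic. \<open>gen_induct\<close> reduces all
  multipliers to constants and variables.\<close>

lemma ideal_fat: "ideal fat_ideal coord_ring_A3"
proof (rule ideal_class_ringI)
  show "0 \<in> fat_ideal" by (simp add: fat_ideal_def)
  show add: "a + b \<in> fat_ideal" if "a \<in> fat_ideal" "b \<in> fat_ideal" for a b
    using that by (auto simp: fat_ideal_def) (simp add: algebra_simps)
  have "\<forall>a\<in>fat_ideal. r * a \<in> fat_ideal" for r
    by (rule gen_induct[where r = r and Q = "\<lambda>r. \<forall>a\<in>fat_ideal. r * a \<in> fat_ideal"])
      (use add in \<open>auto simp: distrib_right mult.assoc\<close>, auto simp: fat_ideal_def distrib_left[symmetric])
  then show "r * a \<in> fat_ideal" if "a \<in> fat_ideal" for r a using that by blast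
qed

text \<open>Stated for any set \<open>Q\<close> with the closure properties of an ideal, so that it
  serves as an induction along the eight generators.\<close>

lemma fat_generators:
  assumes zero: "0 \<in> Q" and add: "\<And>a b. a \<in> Q \<Longrightarrow> b \<in> Q \<Longrightarrow> a + b \<in> Q"
    and mult: "\<And>r a. a \<in> Q \<Longrightarrow> r * a \<in> Q"
    and gens: "mon 1 0 3 0 - mon 1 1 0 1 \<in> Q" "mon 1 2 0 0 \<in> Q" "mon 1 1 2 0 \<in> Q" "mon 1 1 1 1 \<in> Q"
      "mon 1 1 0 2 \<in> Q" "mon 1 0 2 2 \<in> Q" "mon 1 0 1 3 \<in> Q" "mon 1 0 0 4 \<in> Q"
    and r: "r \<in> fat_ideal"
  shows "r \<in> Q"
proof -
  \<comment> \<open>The two missing monomials of weight 4, y^4 and y^3 z, are y and z times the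
    cubic, plus xyz and xz^2.\<close>
  have "mon 1 0 1 0 * (mon 1 0 3 0 - mon 1 1 0 1) + mon 1 1 1 1 \<in> Q"
    "mon 1 0 0 1 * (mon 1 0 3 0 - mon 1 1 0 1) + mon 1 1 0 2 \<in> Q"
    by (intro add mult gens)+
  then have g: "mon 1 0 4 0 \<in> Q" "mon 1 0 3 1 \<in> Q"
    by (simp_all add: algebra_simps mon_mult numeral_2_eq_2)
  have divides: "mon c i j k \<in> Q" if "mon 1 a b d \<in> Q" "a \<le> i" "b \<le> j" "d \<le> k" for c i j k a b d
    using mult[OF that(1), of "mon c (i - a) (j - b) (k - d)"] that by (simp add: mon_mult)
  define h where "h = mon 1 0 3 0 - mon 1 1 0 1"
  \<comment> \<open>This removes y^3 and xz together, since their coefficients in \<open>r\<close>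
    sum to 0; only weight at least 4 is left.\<close>
  define s where "s = r - const_A3 (coeff3 r 0 3 0) * h"
  have "s \<in> Q"
  proof (rule mon_induct[where Q = "\<lambda>r. r \<in> Q", OF add])
    fix i j k :: nat
    show "mon (coeff3 s i j k) i j k \<in> Q"
    proof (cases "2 * i + j + k < 4")
      case True
      then have "i \<in> {0, 1}" "j \<in> {0, 1, 2, 3}" "k \<in> {0, 1, 2, 3}" by auto
      with True have "coeff3 s i j k = 0"
        using r by (auto simp: s_def h_def fat_ideal_def add_eq_0_iff2)
      then show ?thesis by (simp add: mon_def zero)
    next
      case False
      \<comment> \<open>Divisibility by one of the nine monomials of weight 4.\<close>
      then have "i \<ge> 2 \<or> i \<ge> 1 \<and> j \<ge> 2 \<or> i \<ge> 1 \<and> j \<ge> 1 \<and> k \<ge> 1 \<or> i \<ge> 1 \<and> k \<ge> 2 \<or>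
          j \<ge> 4 \<or> j \<ge> 3 \<and> k \<ge> 1 \<or> j \<ge> 2 \<and> k \<ge> 2 \<or> j \<ge> 1 \<and> k \<ge> 3 \<or> k \<ge> 4"
        by presburger
      then show ?thesis
        by (elim disjE conjE) (auto intro: divides[OF gens(2)] divides[OF gens(3)]
          divides[OF gens(4)] divides[OF gens(5)] divides[OF gens(6)] divides[OF gens(7)]
          divides[OF gens(8)] divides[OF g(1)] divides[OF g(2)])
    qed
  qed
  moreover have "const_A3 (coeff3 r 0 3 0) * h \<in> Q" unfolding h_def by (intro mult gens)
  ultimately have "s + const_A3 (coeff3 r 0 3 0) * h \<in> Q" by (rule add)
  then show ?thesis by (simp add: s_def)
qed


abbreviation "X \<equiv> mon 1 1 0 0"
abbreviation "Y \<equiv> mon 1 0 1 0"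
abbreviation "Z \<equiv> mon 1 0 0 1"

text \<open>
  In the application \<open>a\<close>, \<open>b\<^sub>1\<close>, \<open>b\<^sub>2\<close>, \<open>b\<^sub>3\<close>, \<open>c\<^sub>i\<close>, \<open>u\<close> are the values of a homomorphism at \<open>x\<^sup>2\<close>,
  \<open>xy\<^sup>2\<close>, \<open>xyz\<close>, \<open>xz\<^sup>2\<close>, \<open>y\<^bsup>4-i\<^esup>z\<^sup>i\<close>, \<open>y\<^sup>3 - xz\<close>. Up to the multiple \<open>- coeff3 u 0 0 1\<close> of \<open>\<partial>/\<partial>x\<close> they
  lie in weight at least \<open>3\<close>, respectively at least \<open>2\<close> for \<open>u\<close>.
\<close>

lemma fat_relations:
  assumes c: "Z * c0 - Y * c1 \<in> fat_ideal" "Z * c1 - Y * c2 \<in> fat_ideal" "Z * c2 - Y * c3 \<in> fat_ideal" "Z * c3 - Y * c4 \<in> fat_ideal"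
    and b: "Z * b1 - Y * b2 \<in> fat_ideal" "Z * b2 - Y * b3 \<in> fat_ideal"
    and u: "Y * u - (c0 - b2) \<in> fat_ideal" "Z * u - (c1 - b3) \<in> fat_ideal" "X * u - (Y * b1 - Z * a) \<in> fat_ideal"
  shows "\<forall>c\<in>{c2, c3, c4}. coeff3 c 0 0 0 = 0 \<and> coeff3 c 0 1 0 = 0 \<and> coeff3 c 0 0 1 = 0 \<and> coeff3 c 1 0 0 = 0 \<and>
      coeff3 c 0 2 0 = 0 \<and> coeff3 c 0 1 1 = 0 \<and> coeff3 c 0 0 2 = 0"
    and "\<forall>b\<in>{b1, b2, b3}. coeff3 b 0 0 0 = 0 \<and> coeff3 b 0 1 0 = 0 \<and> coeff3 b 0 0 1 = 0 \<and> coeff3 b 1 0 0 = 0"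
    and "coeff3 b1 0 2 0 = - coeff3 u 0 0 1" "coeff3 b1 0 1 1 = 0" "coeff3 b1 0 0 2 = 0"
    and "coeff3 b2 0 2 0 = 0" "coeff3 b2 0 1 1 = - coeff3 u 0 0 1" "coeff3 b2 0 0 2 = 0"
    and "coeff3 b3 0 2 0 = 0" "coeff3 b3 0 1 1 = 0" "coeff3 b3 0 0 2 = - coeff3 u 0 0 1"
    and "coeff3 a 0 0 0 = 0" "coeff3 a 0 1 0 = 0" "coeff3 a 0 0 1 = 0" "coeff3 a 1 0 0 = - 2 * coeff3 u 0 0 1"
      "coeff3 a 0 2 0 = 0" "coeff3 a 0 1 1 = 0" "coeff3 a 0 0 2 = 0"
    and "coeff3 u 0 0 0 = 0" "coeff3 u 0 1 0 = 0"
proof -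
  show "\<forall>c\<in>{c2, c3, c4}. coeff3 c 0 0 0 = 0 \<and> coeff3 c 0 1 0 = 0 \<and> coeff3 c 0 0 1 = 0 \<and> coeff3 c 1 0 0 = 0 \<and>
      coeff3 c 0 2 0 = 0 \<and> coeff3 c 0 1 1 = 0 \<and> coeff3 c 0 0 2 = 0" using c by (simp add: fat_ideal_def)
  \<comment> \<open>The first equation compares coefficients of z^2 in the relation for
    \<open>Z * u\<close>. The second is the condition on xz and y^3 in the relation for
    \<open>X * u\<close>, where the y^2-coefficient of \<open>b1\<close> equals the z^2-coefficient
    of \<open>b3\<close> by the two relations among the \<open>b\<close>'s.\<close>
  have "coeff3 u 0 0 1 + coeff3 b3 0 0 2 = 0" "coeff3 u 0 0 1 + coeff3 a 1 0 0 = coeff3 b3 0 0 2"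
    using assms by (simp_all add: fat_ideal_def)
  then have "coeff3 b3 0 0 2 = - coeff3 u 0 0 1" "coeff3 a 1 0 0 = coeff3 b3 0 0 2 - coeff3 u 0 0 1"
    by (simp_all add: eq_neg_iff_add_eq_0 eq_diff_eq add.commute)
  then show "coeff3 a 1 0 0 = - 2 * coeff3 u 0 0 1" by simp
qed (use assms in \<open>simp_all add: fat_ideal_def eq_neg_iff_add_eq_0 add.commute\<close>)

section \<open>Explicit homomorphisms on the fat ideal\<close>

definition dx :: "poly3 \<Rightarrow> poly3" where
  "dx = map_poly (map_poly pderiv)"

lemma coeff3_dx [simp]: "coeff3 (dx r) i j k = of_nat (i + 1) * coeff3 r (i + 1) j k"
  by (simp add: dx_def coeff3_def coeff_map_poly coeff_pderiv)

text \<open>The multipliers \<open>r\<close> with which \<open>g\<close> commutes modulo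
  \<open>I\<close> are closed under products, and under sums because of \<open>add\<close>; hence
  constants and variables suffice.\<close>

lemma hom_mod_generatorsI:
  assumes I: "ideal I coord_ring_A3"
    and add: "\<And>a b. a \<in> I \<Longrightarrow> b \<in> I \<Longrightarrow> g (a + b) - (g a + g b) \<in> I"
    and const: "\<And>c a. a \<in> I \<Longrightarrow> g (const_A3 c * a) - const_A3 c * g a \<in> I"
    and gen: "\<And>a. a \<in> I \<Longrightarrow> g (X * a) - X * g a \<in> I" "\<And>a. a \<in> I \<Longrightarrow> g (Y * a) - Y * g a \<in> I"
      "\<And>a. a \<in> I \<Longrightarrow> g (Z * a) - Z * g a \<in> I"
  shows "hom_mod I g"
proof -
  note closed = ideal_add[OF I] ideal_mult[OF I]
  have "\<forall>a\<in>I. g (r * a) - r * g a \<in> I" for r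
  proof (rule gen_induct[where r = r and Q = "\<lambda>r. \<forall>a\<in>I. g (r * a) - r * g a \<in> I"])
    fix p q assume IH: "\<forall>a\<in>I. g (p * a) - p * g a \<in> I" "\<forall>a\<in>I. g (q * a) - q * g a \<in> I"
    have "(g (p * a + q * a) - (g (p * a) + g (q * a))) + ((g (p * a) - p * g a) + (g (q * a) - q * g a)) \<in> I"
      if "a \<in> I" for a
      using IH that by (intro closed add) auto
    then show "\<forall>a\<in>I. g ((p + q) * a) - (p + q) * g a \<in> I"
      by (simp add: algebra_simps)
    have "(g (p * (q * a)) - p * g (q * a)) + p * (g (q * a) - q * g a) \<in> I" if "a \<in> I" for a
      using IH that by (intro closed) (auto intro: closed)
    then show "\<forall>a\<in>I. g (p * q * a) - p * q * g a \<in> I"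
      by (simp add: algebra_simps)
  qed (use const gen in auto)
  with add show ?thesis by (simp add: hom_mod_def)
qed

text \<open>
  A homomorphism may send \<open>y\<^sup>3 - xz\<close> to any element of weight at least \<open>2\<close> (index \<open>Low\<close>); the
  monomials of weight \<open>4\<close> go to arbitrary elements of weight \<open>3\<close> (index \<open>Top\<close>), except that the
  values at \<open>y\<^sup>4\<close> and \<open>y\<^sup>3z\<close> are forced by those at \<open>y\<^sup>3 - xz\<close>, \<open>xyz\<close> and \<open>xz\<^sup>2\<close>. The only
  further homomorphism is the translation \<open>\<partial>/\<partial>x\<close>.
\<close>

datatype tangent_index = Low "nat \<times> nat \<times> nat" | Top nat "nat \<times> nat \<times> nat" | Trans

definition low_exps :: "(nat \<times> nat \<times> nat) set" where
  "low_exps = {(1,0,0), (0,2,0), (0,1,1), (0,0,2), (1,1,0), (1,0,1), (0,2,1), (0,1,2), (0,0,3)}"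

definition top_exps :: "(nat \<times> nat \<times> nat) set" where
  "top_exps = {(1,1,0), (1,0,1), (0,2,1), (0,1,2), (0,0,3)}"

text \<open>Coordinates dual to \<open>quartics\<close> that vanish on (x, y, z) times the fat
  ideal. Modulo that product y^4 agrees with xyz and y^3 z with xz^2, whence the two sums.\<close>

definition top_functional :: "nat \<Rightarrow> poly3 \<Rightarrow> complex" where
  "top_functional t r = [coeff3 r 2 0 0, coeff3 r 1 2 0, coeff3 r 1 1 1 + coeff3 r 0 4 0, coeff3 r 1 0 2 + coeff3 r 0 3 1,
     coeff3 r 0 2 2, coeff3 r 0 1 3, coeff3 r 0 0 4] ! t"

text \<open>In the \<open>Low\<close> case the cubic goes to the monomial u while xyz and xz^2 go to
  0, which forces the values yu at y^4 and zu at y^3 z.\<close>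

fun loc_hom :: "tangent_index \<Rightarrow> poly3 \<Rightarrow> poly3" where
  "loc_hom (Low u) r = (case u of (a, b, c) \<Rightarrow>
     mon (coeff3 r 0 3 0) a b c + mon (coeff3 r 0 4 0) a (b + 1) c + mon (coeff3 r 0 3 1) a b (c + 1))"
| "loc_hom (Top t u) r = (case u of (a, b, c) \<Rightarrow> mon (top_functional t r) a b c)"
| "loc_hom Trans r = dx r"

definition loc_index :: "tangent_index set" where
  "loc_index = Low ` low_exps \<union> (case_prod Top) ` ({..<7} \<times> top_exps) \<union> {Trans}"

lemma mon_add: "mon (c + d) i j k = mon c i j k + mon d i j k"
  by (simp add: mon_def add_monom[symmetric])

lemma mon_const_mult: "mon (c * d) i j k = const_A3 c * mon d i j k"
  by (simp add: const_A3_eq_mon mon_mult)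

lemma mon_0 [simp]: "mon 0 i j k = 0"
  by (simp add: mon_def)

lemma zero_in_fat: "0 \<in> fat_ideal"
  by (simp add: fat_ideal_def)

lemma top_functional_add: "t < 7 \<Longrightarrow> top_functional t (a + b) = top_functional t a + top_functional t b"
  and top_functional_const: "t < 7 \<Longrightarrow> top_functional t (const_A3 c * a) = c * top_functional t a"
  by (auto simp: top_functional_def less_Suc_eq numeral_eq_Suc distrib_left)

lemma top_functional_gen:
  assumes "t < 7" "a \<in> fat_ideal"
  shows "top_functional t (X * a) = 0" "top_functional t (Y * a) = 0" "top_functional t (Z * a) = 0"
proof -
  have "t \<in> {0, 1, 2, 3, 4, 5, 6}" using assms by auto
  then show "top_functional t (X * a) = 0" "top_functional t (Y * a) = 0" "top_functional t (Z * a) = 0"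
    using assms(2) by (auto simp: top_functional_def fat_ideal_def)
qed

text \<open>Multiplication by y or z moves the coefficient of y^3 to y^4 or y^3 z, so the leading
  terms cancel. The remaining ones have weight at least 4, as u has weight at least 2.\<close>

lemma hom_mod_Low:
  assumes "(i, j, k) \<in> low_exps"
  shows "hom_mod fat_ideal (loc_hom (Low (i, j, k)))"
proof (rule hom_mod_generatorsI[OF ideal_fat])
  have m: "mon c (Suc i) j k \<in> fat_ideal" "mon c (Suc i) (Suc j) k \<in> fat_ideal" "mon c (Suc i) j (Suc k) \<in> fat_ideal"
      "mon c i (Suc (Suc j)) k \<in> fat_ideal" "mon c i (Suc j) (Suc k) \<in> fat_ideal" "mon c i j (Suc (Suc k)) \<in> fat_ideal" for c
    using assms by (auto simp: low_exps_def fat_ideal_def)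
  note closed = ideal_add[OF ideal_fat] ideal_diff[OF ideal_fat] m
  have neg: "- r = 0 - r" for r :: poly3 by simp
  fix a assume a: "a \<in> fat_ideal"
  show "loc_hom (Low (i, j, k)) (X * a) - X * loc_hom (Low (i, j, k)) a \<in> fat_ideal"
    by (simp add: mon_mult mon_0 distrib_left) (subst neg, intro closed zero_in_fat)
  have eq: "loc_hom (Low (i, j, k)) (Y * a) - Y * loc_hom (Low (i, j, k)) a =
      0 - (mon (coeff3 a 0 4 0) i (Suc (Suc j)) k + mon (coeff3 a 0 3 1) i (Suc j) (Suc k))"
    "loc_hom (Low (i, j, k)) (Z * a) - Z * loc_hom (Low (i, j, k)) a =
      0 - (mon (coeff3 a 0 4 0) i (Suc j) (Suc k) + mon (coeff3 a 0 3 1) i j (Suc (Suc k)))"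
    using a by (simp_all add: mon_mult mon_0 distrib_left fat_ideal_def)
  show "loc_hom (Low (i, j, k)) (Y * a) - Y * loc_hom (Low (i, j, k)) a \<in> fat_ideal"
    "loc_hom (Low (i, j, k)) (Z * a) - Z * loc_hom (Low (i, j, k)) a \<in> fat_ideal"
    unfolding eq by (intro closed zero_in_fat)+
qed (simp_all add: zero_in_fat mon_add mon_const_mult distrib_left add_ac)

text \<open>Both sides of the linearity condition vanish: the functional kills multiples by a
  variable, and variables kill weight 3 in R/I.\<close>

lemma hom_mod_Top:
  assumes "t < 7" "(i, j, k) \<in> top_exps"
  shows "hom_mod fat_ideal (loc_hom (Top t (i, j, k)))"
proof (rule hom_mod_generatorsI[OF ideal_fat])
  have m: "X * mon c i j k \<in> fat_ideal" "Y * mon c i j k \<in> fat_ideal" "Z * mon c i j k \<in> fat_ideal" for c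
    using assms(2) by (auto simp: top_exps_def fat_ideal_def)
  fix a assume a: "a \<in> fat_ideal"
  show "loc_hom (Top t (i, j, k)) (X * a) - X * loc_hom (Top t (i, j, k)) a \<in> fat_ideal"
    "loc_hom (Top t (i, j, k)) (Y * a) - Y * loc_hom (Top t (i, j, k)) a \<in> fat_ideal"
    "loc_hom (Top t (i, j, k)) (Z * a) - Z * loc_hom (Top t (i, j, k)) a \<in> fat_ideal"
    using top_functional_gen[OF assms(1) a] ideal_diff[OF ideal_fat zero_in_fat] m
    by (simp_all add: mon_0)
qed (use assms(1) in \<open>simp_all add: top_functional_add top_functional_const zero_in_fat mon_add mon_const_mult\<close>)

text \<open>By the Leibniz rule the failure of linearity is a multiple of the argument, which lies
  in the ideal.\<close>

lemma hom_mod_Trans: "hom_mod fat_ideal (loc_hom Trans)"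
  by (rule hom_mod_generatorsI[OF ideal_fat]) (simp_all add: fat_ideal_def distrib_left distrib_right mult.left_commute)

lemma hom_mod_loc_hom:
  assumes "s \<in> loc_index"
  shows "hom_mod fat_ideal (loc_hom s)"
  using assms by (auto simp: loc_index_def intro: hom_mod_Low hom_mod_Top hom_mod_Trans)

lemma sum_loc_index:
  fixes h :: "tangent_index \<Rightarrow> poly3"
  shows "sum h loc_index = (\<Sum>u\<in>low_exps. h (Low u)) + (\<Sum>t<7. \<Sum>u\<in>top_exps. h (Top t u)) + h Trans"
proof -
  have fin: "finite low_exps" "finite top_exps" by (simp_all add: low_exps_def top_exps_def)
  have inj: "inj_on Low A" "inj_on (case_prod Top) B" for A B by (auto intro!: inj_onI)
  have "sum h loc_index = sum h (Low ` low_exps) + sum h (case_prod Top ` ({..<7} \<times> top_exps)) + sum h {Trans}"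
    unfolding loc_index_def using fin by (subst sum.union_disjoint; (subst sum.union_disjoint)?) auto
  then show ?thesis
    by (simp add: sum.reindex[OF inj(1)] sum.reindex[OF inj(2), unfolded split_beta'] sum.cartesian_product split_beta' o_def)
qed

section \<open>Values at the generators: independence and spanning\<close>

definition cubic :: poly3 where
  "cubic = mon 1 0 3 0 - mon 1 1 0 1"

definition quartics :: "poly3 list" where
  "quartics = [mon 1 2 0 0, mon 1 1 2 0, mon 1 1 1 1, mon 1 1 0 2,
     mon 1 0 2 2, mon 1 0 1 3, mon 1 0 0 4]"

lemma dx_cubic: "dx cubic = - Z"
  by (rule poly3_eqI) (simp add: cubic_def)

lemma loc_comb_cubic:
  "(\<Sum>s\<in>loc_index. const_A3 (p s) * loc_hom s cubic) =
     (\<Sum>(i, j, k)\<in>low_exps. mon (p (Low (i, j, k))) i j k) - const_A3 (p Trans) * Z"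
proof -
  have "top_functional t cubic = 0" if "t < 7" for t
  proof -
    have "t \<in> {0, 1, 2, 3, 4, 5, 6}" using that by auto
    then show ?thesis by (auto simp: top_functional_def cubic_def)
  qed
  moreover have "coeff3 cubic 0 3 0 = 1" "coeff3 cubic 0 4 0 = 0" "coeff3 cubic 0 3 1 = 0"
    by (simp_all add: cubic_def)
  ultimately show ?thesis unfolding sum_loc_index
    by (simp add: split_beta' mon_const_mult[symmetric] dx_cubic)
qed

lemma loc_comb_quartics:
  assumes "t < 7"
  shows "(\<Sum>s\<in>loc_index. const_A3 (p s) * loc_hom s (quartics ! t)) =
     (\<Sum>(i, j, k)\<in>top_exps. mon (p (Top t (i, j, k))) i j k) + const_A3 (p Trans) * dx (quartics ! t)"
proof -
  have t: "t \<in> {0, 1, 2, 3, 4, 5, 6}" using assms by auto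
  have "top_functional t' (quartics ! t) = (if t' = t then 1 else 0)" if "t' < 7" for t'
  proof -
    have "t' \<in> {0, 1, 2, 3, 4, 5, 6}" using that by auto
    with t show ?thesis by (auto simp: top_functional_def quartics_def)
  qed
  moreover have "loc_hom (Low u) (quartics ! t) = 0" for u
    using t by (cases u) (auto simp: quartics_def)
  moreover have "const_A3 (p (Top t' u)) * mon (if t' = t then 1 else 0) i j k =
      (if t' = t then mon (p (Top t u)) i j k else 0)" for t' u i j k
    by (simp add: mon_const_mult[symmetric])
  ultimately show ?thesis unfolding sum_loc_index using assms
    by (simp add: split_beta' sum.swap[of _ top_exps])
qed

lemma generators_in_fat: "cubic \<in> fat_ideal" "t < 7 \<Longrightarrow> quartics ! t \<in> fat_ideal"
proof -
  show "cubic \<in> fat_ideal" by (simp add: fat_ideal_def cubic_def)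
  have "set quartics \<subseteq> fat_ideal" by (simp add: fat_ideal_def quartics_def)
  then show "t < 7 \<Longrightarrow> quartics ! t \<in> fat_ideal"
    using nth_mem[of t quartics] by (auto simp: quartics_def)
qed

text \<open>The value at \<open>cubic\<close> determines \<open>p Trans\<close>, as the coefficient
  of z, and all \<open>Low\<close> coefficients; with \<open>p Trans = 0\<close> the value at each
  of the \<open>quartics\<close> determines its \<open>Top\<close> coefficients.\<close>

lemma loc_hom_independent:
  assumes "\<And>m. m \<in> fat_ideal \<Longrightarrow> (\<Sum>s\<in>loc_index. const_A3 (p s) * loc_hom s m) \<in> fat_ideal"
    and s: "s \<in> loc_index"
  shows "p s = 0"
proof -
  have "p Trans = 0 \<and> (\<forall>u\<in>low_exps. p (Low u) = 0)"
    using assms(1)[OF generators_in_fat(1)] unfolding loc_comb_cubic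
    by (simp add: low_exps_def fat_ideal_def)
  moreover have "\<forall>u\<in>top_exps. p (Top t u) = 0" if "t < 7" for t
    using assms(1)[OF generators_in_fat(2)[OF that]] \<open>p Trans = 0 \<and> _\<close>
    unfolding loc_comb_quartics[OF that]
    by (simp add: top_exps_def fat_ideal_def const_A3_eq_mon)
  ultimately show ?thesis using s by (auto simp: loc_index_def)
qed

text \<open>The combination \<open>F\<close> is fitted to \<open>G\<close> at the generators.
  \<open>fat_relations\<close> shows that the values of \<open>G\<close> have no components outside
  the reach of \<open>F\<close>, so \<open>G - F\<close> vanishes on generators and therefore on the
  ideal.\<close>

lemma loc_hom_spans:
  assumes G: "hom_mod fat_ideal G"
  shows "\<exists>p. \<forall>m\<in>fat_ideal. G m - (\<Sum>s\<in>loc_index. const_A3 (p s) * loc_hom s m) \<in> fat_ideal"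
proof -
  note closed = ideal_add[OF ideal_fat] ideal_diff[OF ideal_fat] ideal_mult[OF ideal_fat]
  \<comment> \<open>Coordinates in R/I, where y^3 and xz have the same class.\<close>
  define \<nu> where "\<nu> = (\<lambda>r (i, j, k). if (i, j, k) = (1, 0, 1) then coeff3 r 1 0 1 + coeff3 r 0 3 0 else coeff3 r i j k)"
  \<comment> \<open>The sign of the last entry comes from \<open>dx cubic = - Z\<close>.\<close>
  define p where "p = case_tangent_index (\<nu> (G cubic)) (\<lambda>t. \<nu> (G (quartics ! t))) (- coeff3 (G cubic) 0 0 1) "
  define F where "F = (\<lambda>m. \<Sum>s\<in>loc_index. const_A3 (p s) * loc_hom s m)"
  have F: "hom_mod fat_ideal F"
    unfolding F_def by (intro hom_mod_sum hom_mod_mult hom_mod_loc_hom ideal_fat)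
  have mem: "cubic \<in> fat_ideal" "set quartics \<subseteq> fat_ideal" "mon 1 0 4 0 \<in> fat_ideal" "mon 1 0 3 1 \<in> fat_ideal"
    by (simp_all add: fat_ideal_def cubic_def quartics_def)
  have sub: "G (a - b) - (G a - G b) \<in> fat_ideal" if "a \<in> fat_ideal" "b \<in> fat_ideal" for a b
  proof -
    have "G ((a - b) + b) - (G (a - b) + G b) \<in> fat_ideal"
      using G closed(2)[OF that] that(2) unfolding hom_mod_def by blast
    from closed(3)[OF this, of "- 1"] show ?thesis by (simp add: algebra_simps)
  qed
  \<comment> \<open>A syzygy among elements of the ideal becomes a congruence among their values;
    two-term syzygies are the case \<open>t = 0\<close>.\<close>
  have transfer: "r * G a - (s * G b - t * G c) \<in> fat_ideal"
    if "a \<in> fat_ideal" "b \<in> fat_ideal" "c \<in> fat_ideal" "r * a = s * b - t * c" for r s t a b c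
  proof -
    have lin: "G (r' * a') - r' * G a' \<in> fat_ideal" if "a' \<in> fat_ideal" for r' a'
      using G that by (simp add: hom_mod_def)
    have "(G (s * b - t * c) - (G (s * b) - G (t * c))) - (G (r * a) - r * G a) +
        (G (s * b) - s * G b) - (G (t * c) - t * G c) \<in> fat_ideal"
      by (rule closed(2)[OF closed(1)[OF closed(2)[OF sub lin] lin] lin])
        (simp_all add: that closed)
    then show ?thesis unfolding that(4)[symmetric] by (simp add: algebra_simps)
  qed
  have rels: "Z * G (mon 1 0 4 0) - Y * G (mon 1 0 3 1) \<in> fat_ideal"
    "Z * G (mon 1 0 3 1) - Y * G (mon 1 0 2 2) \<in> fat_ideal"
    "Z * G (mon 1 0 2 2) - Y * G (mon 1 0 1 3) \<in> fat_ideal"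
    "Z * G (mon 1 0 1 3) - Y * G (mon 1 0 0 4) \<in> fat_ideal"
    "Z * G (mon 1 1 2 0) - Y * G (mon 1 1 1 1) \<in> fat_ideal"
    "Z * G (mon 1 1 1 1) - Y * G (mon 1 1 0 2) \<in> fat_ideal"
    "Y * G cubic - (G (mon 1 0 4 0) - G (mon 1 1 1 1)) \<in> fat_ideal"
    "Z * G cubic - (G (mon 1 0 3 1) - G (mon 1 1 0 2)) \<in> fat_ideal"
    "X * G cubic - (Y * G (mon 1 1 2 0) - Z * G (mon 1 2 0 0)) \<in> fat_ideal"
    using transfer[of "mon 1 0 4 0" "mon 1 0 3 1" 0 Z Y 0]
      transfer[of "mon 1 0 3 1" "mon 1 0 2 2" 0 Z Y 0]
      transfer[of "mon 1 0 2 2" "mon 1 0 1 3" 0 Z Y 0]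
      transfer[of "mon 1 0 1 3" "mon 1 0 0 4" 0 Z Y 0]
      transfer[of "mon 1 1 2 0" "mon 1 1 1 1" 0 Z Y 0]
      transfer[of "mon 1 1 1 1" "mon 1 1 0 2" 0 Z Y 0]
      transfer[of cubic "mon 1 0 4 0" "mon 1 1 1 1" Y 1 1]
      transfer[of cubic "mon 1 0 3 1" "mon 1 1 0 2" Z 1 1]
      transfer[of cubic "mon 1 1 2 0" "mon 1 2 0 0" X Y Z] mem zero_in_fat
    by (simp_all add: mon_mult quartics_def cubic_def right_diff_distrib numeral_eq_Suc)
  note rel = fat_relations[OF rels]
  have h: "G cubic - F cubic \<in> fat_ideal"
    unfolding F_def loc_comb_cubic using rel by (simp add: low_exps_def p_def \<nu>_def fat_ideal_def)
  have quartics: "G (quartics ! t) - F (quartics ! t) \<in> fat_ideal" if "t \<in> {0, 1, 2, 3, 4, 5, 6}" for t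
    using that unfolding F_def
    by (elim insertE emptyE)
      (simp_all only: loc_comb_quartics less_numeral_extra numeral_less_iff zero_less_numeral one_less_numeral_iff semiring_norm,
       simp_all add: top_exps_def p_def \<nu>_def quartics_def fat_ideal_def rel[simplified])
  have "m \<in> {m \<in> fat_ideal. G m - F m \<in> fat_ideal}" if "m \<in> fat_ideal" for m
  proof (rule fat_generators[OF _ _ _ _ _ _ _ _ _ _ _ that])
    note H = hom_mod_diff[OF ideal_fat G F]
    show "0 \<in> {m \<in> fat_ideal. G m - F m \<in> fat_ideal}"
      using hom_mod_kernel_zero[OF ideal_fat H] zero_in_fat by simp
    show "a + b \<in> {m \<in> fat_ideal. G m - F m \<in> fat_ideal}"
      if "a \<in> {m \<in> fat_ideal. G m - F m \<in> fat_ideal}" "b \<in> {m \<in> fat_ideal. G m - F m \<in> fat_ideal}" for a b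
      using hom_mod_kernel_add[OF ideal_fat H, of a b] that by (simp add: closed)
    show "r * a \<in> {m \<in> fat_ideal. G m - F m \<in> fat_ideal}" if "a \<in> {m \<in> fat_ideal. G m - F m \<in> fat_ideal}" for r a
      using hom_mod_kernel_mult[OF ideal_fat H, of a r] that by (simp add: closed)
  qed (use h quartics[of 0] quartics[of 1] quartics[of 2] quartics[of 3] quartics[of 4] quartics[of 5] quartics[of 6] mem in
      \<open>simp_all add: cubic_def quartics_def\<close>)
  then show ?thesis unfolding F_def by blast
qed


subsection \<open>Adding reduced points\<close>

text \<open>Evaluation at the point (k, 0, 0).\<close>

definition point_eval :: "nat \<Rightarrow> poly3 \<Rightarrow> complex" where
  "point_eval k r = poly (coeff (coeff r 0) 0) (of_nat k)"

text \<open>The partial derivatives along x, y, z at (k, 0, 0), dual to the local parameters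
  \<open>param\<close>.\<close>

definition der :: "nat \<Rightarrow> nat \<Rightarrow> poly3 \<Rightarrow> complex" where
  "der t k r = [poly (pderiv (coeff (coeff r 0) 0)) (of_nat k),
     poly (coeff (coeff r 0) 1) (of_nat k), poly (coeff (coeff r 1) 0) (of_nat k)] ! t"

definition param :: "nat \<Rightarrow> nat \<Rightarrow> poly3" where
  "param t k = [X - const_A3 (of_nat k), Y, Z] ! t"

lemma point_eval_simps [simp]:
  "point_eval k 0 = 0" "point_eval k 1 = 1" "point_eval k (r + s) = point_eval k r + point_eval k s" "point_eval k (r - s) = point_eval k r - point_eval k s"
  "point_eval k (r * s) = point_eval k r * point_eval k s" "point_eval k (const_A3 c) = c"
  by (simp_all add: point_eval_def coeff_mult_0 const_A3_def)

lemma point_eval_sum [simp]: "point_eval k (\<Sum>s\<in>S. h s) = (\<Sum>s\<in>S. point_eval k (h s))"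
  by (induction S rule: infinite_finite_induct) auto

lemma lt_3: "t < 3 \<Longrightarrow> t \<in> {0, 1, 2 :: nat}"
  by auto

lemma der_add: "t < 3 \<Longrightarrow> der t k (r + s) = der t k r + der t k s"
  by (drule lt_3) (auto simp: der_def pderiv_add)

lemma der_mult: "t < 3 \<Longrightarrow> der t k (r * s) = point_eval k r * der t k s + der t k r * point_eval k s"
  by (drule lt_3) (auto simp: der_def point_eval_def coeff_mult pderiv_mult algebra_simps)

lemma pt_param: "t < 3 \<Longrightarrow> point_eval k (param t k) = 0"
  by (drule lt_3) (auto simp: param_def point_eval_def mon_def const_A3_def poly_monom)

lemma der_param: "t < 3 \<Longrightarrow> t' < 3 \<Longrightarrow> der t k (param t' k) = (if t = t' then 1 else 0)"
  by (drule lt_3, drule lt_3)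
    (auto simp: param_def der_def mon_def const_A3_def poly_monom pderiv_diff pderiv_monom pderiv_pCons)

text \<open>The maximal ideal of (k, 0, 0) is generated by x - k, y, z: splitting off multiples of z
  and then of y leaves a polynomial in x with root k.\<close>

lemma pt_zero_decomp:
  assumes "point_eval k r = 0"
  obtains A where "r = (\<Sum>t<3. param t k * A t)"
proof -
  obtain a C where r: "r = pCons a C" by (cases r)
  obtain b B where a: "a = pCons b B" by (cases a)
  have "poly b (of_nat k) = 0" using assms by (simp add: point_eval_def r a)
  then obtain q where b: "b = [:- of_nat k, 1:] * q" by (auto simp: poly_eq_0_iff_dvd)
  have "r = (X - const_A3 (of_nat k)) * [:[:q:]:] + (Y * [:B:] + Z * C)"
    by (simp add: r a b mon_def const_A3_def monom_0 monom_Suc pCons_one)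
  then have "r = (\<Sum>t<3. param t k * ([[:[:q:]:], [:B:], C] ! t))"
    by (simp add: param_def numeral_3_eq_3 numeral_2_eq_2 add_ac)
  then show thesis by (rule that)
qed

text \<open>Lagrange interpolation in x, with an extra factor x^2 that puts \<open>e k\<close> into
  \<open>fat_ideal\<close>. Its value k^2 at the point is divided out, which is possible as k is at
  least 1.\<close>

lemma separating_elements:
  "\<exists>e. \<forall>k\<in>{1..n}. (\<exists>g. e k = mon 1 2 0 0 * g) \<and> (\<forall>l\<in>{1..n}. point_eval l (e k) = (if l = k then 1 else 0))"
proof (rule exI, intro ballI conjI)
  define q :: "nat \<Rightarrow> complex poly" where "q k = (\<Prod>l\<in>{1..n} - {k}. [:- of_nat l, 1:])" for k
  let ?e = "\<lambda>k. mon 1 2 0 0 * [:[:Polynomial.smult (inverse (of_nat k ^ 2 * poly (q k) (of_nat k))) (q k):]:]"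
  fix k l assume k: "k \<in> {1..n}" and l: "l \<in> {1..n}"
  show "\<exists>g. ?e k = mon 1 2 0 0 * g" by blast
  have "poly (q k) (of_nat k) \<noteq> 0" by (auto simp: q_def poly_prod)
  moreover have "(of_nat k :: complex) \<noteq> 0" using k by auto
  moreover have "poly (q k) (of_nat l) = 0" if "l \<noteq> k" using l that by (auto simp: q_def poly_prod)
  ultimately show "point_eval l (?e k) = (if l = k then 1 else 0)"
    using k by (simp add: point_eval_def coeff_mult_0 mon_def poly_monom field_simps)
qed

definition fat_points :: "nat \<Rightarrow> poly3 set" where
  "fat_points n = {r \<in> fat_ideal. \<forall>k\<in>{1..n}. point_eval k r = 0}"

lemma fat_points_iff: "r \<in> fat_points n \<longleftrightarrow> r \<in> fat_ideal \<and> (\<forall>k\<in>{1..n}. point_eval k r = 0)"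
  by (simp add: fat_points_def)

lemma ideal_fat_points: "ideal (fat_points n) coord_ring_A3"
  by (rule ideal_class_ringI)
    (auto simp: fat_points_iff zero_in_fat ideal_add[OF ideal_fat] ideal_mult[OF ideal_fat])

section \<open>Gluing the fat point and the reduced points\<close>

context
  fixes n :: nat and e :: "nat \<Rightarrow> poly3"
  assumes e_mult: "\<And>k. k \<in> {1..n} \<Longrightarrow> \<exists>g. e k = mon 1 2 0 0 * g"
    and pt_e: "\<And>k l. k \<in> {1..n} \<Longrightarrow> l \<in> {1..n} \<Longrightarrow> point_eval l (e k) = (if l = k then 1 else 0)"
begin

lemma e_in_fat: "k \<in> {1..n} \<Longrightarrow> r * e k \<in> fat_ideal" "k \<in> {1..n} \<Longrightarrow> e k * r \<in> fat_ideal"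
proof -
  assume "k \<in> {1..n}"
  then obtain g where "e k = mon 1 2 0 0 * g" using e_mult by blast
  then show "e k * r \<in> fat_ideal" by (simp add: fat_ideal_def mult.assoc)
  then show "r * e k \<in> fat_ideal" by (simp add: mult.commute)
qed

lemma e_in_fat_points: "k \<in> {1..n} \<Longrightarrow> point_eval k r = 0 \<Longrightarrow> e k * r \<in> fat_points n"
  by (auto simp: fat_points_iff e_in_fat pt_e)

lemma pt_sum_e:
  assumes "l \<in> {1..n}"
  shows "point_eval l (\<Sum>k=1..n. e k * h k) = point_eval l (h l)"
proof -
  have "point_eval l (\<Sum>k=1..n. e k * h k) = (\<Sum>k=1..n. if l = k then point_eval l (h k) else 0)"
    unfolding point_eval_sum point_eval_simps using assms by (intro sum.cong) (auto simp: pt_e)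
  with assms show ?thesis by (simp del: point_eval_sum)
qed

text \<open>Vanishes at the reduced points and is congruent to \<open>1\<close> modulo \<open>fat_ideal\<close>.\<close>

definition cutoff :: poly3 where
  "cutoff = 1 - (\<Sum>k=1..n. e k)"

lemma point_eval_cutoff: "k \<in> {1..n} \<Longrightarrow> point_eval k cutoff = 0"
  by (simp add: cutoff_def pt_e)

lemma cutoff_mult: "r \<in> fat_ideal \<Longrightarrow> cutoff * r \<in> fat_points n"
  by (simp add: fat_points_iff ideal_mult[OF ideal_fat] point_eval_cutoff)

lemma cutoff_cong: "cutoff * r \<in> fat_ideal \<longleftrightarrow> r \<in> fat_ideal"
proof -
  have s: "(\<Sum>k=1..n. e k) * r \<in> fat_ideal"
    unfolding sum_distrib_right by (intro ideal_sum[OF ideal_fat] e_in_fat)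
  have "cutoff * r = r - (\<Sum>k=1..n. e k) * r" by (simp add: cutoff_def left_diff_distrib)
  then show ?thesis
    using ideal_diff[OF ideal_fat _ s, of r] ideal_add[OF ideal_fat _ s, of "cutoff * r"] by auto
qed

lemma cutoff_cong_diff: "cutoff * r - r \<in> fat_ideal"
proof -
  have "0 - (\<Sum>k=1..n. e k) * r \<in> fat_ideal"
    unfolding sum_distrib_right
    by (intro ideal_diff[OF ideal_fat] ideal_sum[OF ideal_fat] e_in_fat zero_in_fat)
  then show ?thesis by (simp add: cutoff_def left_diff_distrib)
qed

definition quot_basis :: "(nat \<times> nat \<times> nat) + nat \<Rightarrow> poly3" where
  "quot_basis = case_sum (\<lambda>(i, j, k). mon 1 i j k) e"

text \<open>Exponents of a monomial basis modulo \<open>fat_ideal\<close>: all of weight at most 3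
  except y^3, which is congruent to xz.\<close>

definition quot_exps :: "(nat \<times> nat \<times> nat) set" where
  "quot_exps = {(0,0,0), (0,1,0), (0,0,1)} \<union> low_exps"

lemma quot_comb:
  "(\<Sum>s\<in>quot_exps <+> {1..n}. const_A3 (p s) * quot_basis s) =
     (\<Sum>u\<in>quot_exps. const_A3 (p (Inl u)) * quot_basis (Inl u)) + (\<Sum>k=1..n. const_A3 (p (Inr k)) * e k)"
  by (subst sum.Plus) (simp_all add: quot_exps_def low_exps_def quot_basis_def)

text \<open>Chinese remaindering by hand: the monomials settle the class modulo
  \<open>fat_ideal\<close>, and the \<open>e k\<close>, which lie in that ideal, then correct the
  values at the reduced points.\<close>

lemma quotient_dim:
  "vectorspace.fin_dim complex_field (quotient_space_A3 (fat_points n)) \<and>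
   vectorspace.dim complex_field (quotient_space_A3 (fat_points n)) = 12 + n"
proof -
  have es: "(\<Sum>k=1..n. const_A3 (p k) * e k) \<in> fat_ideal" for p
    by (intro ideal_sum[OF ideal_fat] e_in_fat)
  have pts: "point_eval l (\<Sum>k=1..n. const_A3 (p k) * e k) = p l" if "l \<in> {1..n}" for p l
    using pt_sum_e[OF that, of "\<lambda>k. const_A3 (p k)"] by (simp add: mult.commute del: point_eval_sum)
  have "card (quot_exps <+> {1..n}) = 12 + n"
    by (subst card_Plus) (simp_all add: quot_exps_def low_exps_def)
  moreover have "vectorspace.fin_dim complex_field (quotient_space_A3 (fat_points n)) \<and>
    vectorspace.dim complex_field (quotient_space_A3 (fat_points n)) = card (quot_exps <+> {1..n})"
  proof (rule dim_quotient_space_A3[OF ideal_fat_points])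
    show "finite (quot_exps <+> {1..n})" by (simp add: quot_exps_def low_exps_def)
  next
    fix r
    define p1 where "p1 = (\<lambda>(i, j, k). if (i, j, k) = (1, 0, 1) then coeff3 r 1 0 1 + coeff3 r 0 3 0 else coeff3 r i j k)"
    define s where "s = r - (\<Sum>u\<in>quot_exps. const_A3 (p1 u) * quot_basis (Inl u))"
    have "s \<in> fat_ideal"
      by (simp add: s_def fat_ideal_def quot_exps_def low_exps_def quot_basis_def p1_def)
    then have "s - (\<Sum>k=1..n. const_A3 (point_eval k s) * e k) \<in> fat_points n"
      using ideal_diff[OF ideal_fat _ es] by (simp add: fat_points_iff pts del: point_eval_sum One_nat_def)
    then have "r - (\<Sum>s'\<in>quot_exps <+> {1..n}. const_A3 (case_sum p1 (\<lambda>k. point_eval k s) s') * quot_basis s') \<in> fat_points n"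
      unfolding quot_comb by (simp add: s_def algebra_simps)
    then show "\<exists>p. r - (\<Sum>s\<in>quot_exps <+> {1..n}. const_A3 (p s) * quot_basis s) \<in> fat_points n" by blast
  next
    fix p s assume comb: "(\<Sum>s\<in>quot_exps <+> {1..n}. const_A3 (p s) * quot_basis s) \<in> fat_points n"
      and s: "s \<in> quot_exps <+> {1..n}"
    have "(\<Sum>u\<in>quot_exps. const_A3 (p (Inl u)) * quot_basis (Inl u)) \<in> fat_ideal"
      using ideal_diff[OF ideal_fat conjunct1[OF comb[unfolded quot_comb fat_points_iff]]
        es[of "\<lambda>k. p (Inr k)"]] unfolding add_diff_cancel_right' .
    then have p1: "\<forall>u\<in>quot_exps. p (Inl u) = 0"
      by (simp add: fat_ideal_def quot_exps_def low_exps_def quot_basis_def)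
    then have "p (Inr k) = 0" if "k \<in> {1..n}" for k
      using comb that pts[OF that, of "\<lambda>k. p (Inr k)"]
      unfolding quot_comb fat_points_iff by (simp add: const_A3_eq_mon del: point_eval_sum One_nat_def)
    with p1 s show "p s = 0" by auto
  qed
  ultimately show ?thesis by simp
qed


section \<open>The tangent space at the union\<close>

definition tangent_hom :: "tangent_index + nat \<times> nat \<Rightarrow> poly3 \<Rightarrow> poly3" where
  "tangent_hom = case_sum (\<lambda>s r. cutoff * loc_hom s r) (\<lambda>(k, t) r. e k * const_A3 (der t k r))"

definition tangent_indices :: "(tangent_index + nat \<times> nat) set" where
  "tangent_indices = loc_index <+> ({1..n} \<times> {..<3})"

lemma finite_loc_index: "finite loc_index"
  by (simp add: loc_index_def low_exps_def top_exps_def)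

lemma card_tangent_indices: "card tangent_indices = 45 + 3 * n"
proof -
  \<comment> \<open>The count is 9 + 7 * 5 + 1, read off from a sum of ones in \<open>poly3\<close>,
    which has characteristic 0.\<close>
  have "of_nat (card loc_index) = (45 :: poly3)"
    using sum_loc_index[of "\<lambda>_. 1"] by (simp add: low_exps_def top_exps_def)
  then have "card loc_index = 45"
    by (metis of_nat_eq_iff of_nat_numeral)
  then show ?thesis
    using finite_loc_index unfolding tangent_indices_def by (subst card_Plus) auto
qed

lemma tangent_comb:
  "(\<Sum>s\<in>tangent_indices. const_A3 (p s) * tangent_hom s r) =
     cutoff * (\<Sum>s\<in>loc_index. const_A3 (p (Inl s)) * loc_hom s r) +
     (\<Sum>k=1..n. e k * (\<Sum>t<3. const_A3 (p (Inr (k, t)) * der t k r)))"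
proof -
  have m: "const_A3 (c * d) = const_A3 c * const_A3 d" for c d
    by (simp add: const_A3_eq_mon mon_mult)
  have "(\<Sum>s\<in>tangent_indices. const_A3 (p s) * tangent_hom s r) =
     (\<Sum>s\<in>loc_index. const_A3 (p (Inl s)) * (cutoff * loc_hom s r)) +
     (\<Sum>k=1..n. \<Sum>t<3. const_A3 (p (Inr (k, t))) * (e k * const_A3 (der t k r)))"
    unfolding tangent_indices_def
    by (subst sum.Plus) (auto simp: finite_loc_index tangent_hom_def sum.cartesian_product intro!: sum.cong)
  then show ?thesis by (simp add: sum_distrib_left mult.left_commute m)
qed

lemma tangent_comb_mod_fat:
  "(\<Sum>s\<in>tangent_indices. const_A3 (p s) * tangent_hom s r) -
     (\<Sum>s\<in>loc_index. const_A3 (p (Inl s)) * loc_hom s r) \<in> fat_ideal"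
proof -
  have "(\<Sum>k=1..n. e k * (\<Sum>t<3. const_A3 (p (Inr (k, t)) * der t k r))) \<in> fat_ideal"
    by (intro ideal_sum[OF ideal_fat] e_in_fat)
  from ideal_add[OF ideal_fat cutoff_cong_diff[of "\<Sum>s\<in>loc_index. const_A3 (p (Inl s)) * loc_hom s r"] this] show ?thesis
    unfolding tangent_comb by (simp add: algebra_simps)
qed

lemma pt_tangent_comb:
  assumes "l \<in> {1..n}"
  shows "point_eval l (\<Sum>s\<in>tangent_indices. const_A3 (p s) * tangent_hom s r) =
     (\<Sum>t<3. p (Inr (l, t)) * der t l r)"
  unfolding tangent_comb point_eval_simps pt_sum_e[OF assms] using assms by (simp add: point_eval_cutoff)

text \<open>The factor \<open>cutoff\<close> turns congruences modulo \<open>fat_ideal\<close> into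
  congruences modulo \<open>fat_points n\<close>. The factor \<open>e k\<close> leaves only a
  condition at the point k, where the Leibniz rule is linear on elements vanishing there.\<close>

lemma hom_mod_tangent_hom:
  assumes "s \<in> tangent_indices"
  shows "hom_mod (fat_points n) (tangent_hom s)"
  using assms unfolding tangent_indices_def
proof (elim PlusE)
  fix s' assume s: "s = Inl s'" "s' \<in> loc_index"
  note H = hom_mod_loc_hom[OF s(2)]
  have "cutoff * (loc_hom s' (a + b) - (loc_hom s' a + loc_hom s' b)) \<in> fat_points n"
    if "a \<in> fat_points n" "b \<in> fat_points n" for a b
    by (intro cutoff_mult) (use H that in \<open>simp add: hom_mod_def fat_points_iff\<close>)
  moreover have "cutoff * (loc_hom s' (r * a) - r * loc_hom s' a) \<in> fat_points n"
    if "a \<in> fat_points n" for a r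
    by (intro cutoff_mult) (use H that in \<open>simp add: hom_mod_def fat_points_iff\<close>)
  ultimately show ?thesis
    by (simp add: hom_mod_def s(1) tangent_hom_def right_diff_distrib distrib_left mult.left_commute)
next
  fix kt assume "s = Inr kt" "kt \<in> {1..n} \<times> {..<3}"
  then obtain k t where s: "s = Inr (k, t)" "k \<in> {1..n}" "t < 3" by auto
  have "e k * (const_A3 (der t k (a + b)) - (const_A3 (der t k a) + const_A3 (der t k b))) \<in> fat_points n"
    for a b
    by (rule e_in_fat_points[OF s(2)]) (simp add: der_add[OF s(3)])
  moreover have "e k * (const_A3 (der t k (r * a)) - r * const_A3 (der t k a)) \<in> fat_points n"
    if "a \<in> fat_points n" for a r
    by (intro e_in_fat_points[OF s(2)]) (use that s(2) in \<open>simp add: der_mult[OF s(3)] fat_points_iff\<close>)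
  ultimately show ?thesis
    by (simp add: hom_mod_def s(1) tangent_hom_def right_diff_distrib distrib_left mult.left_commute)
qed

lemma param_e: "k \<in> {1..n} \<Longrightarrow> t < 3 \<Longrightarrow> e k * param t k \<in> fat_points n"
  by (simp add: e_in_fat_points pt_param)

text \<open>Composing \<open>g\<close> with multiplication by \<open>cutoff\<close> gives a
  homomorphism on \<open>fat_ideal\<close>, which \<open>loc_hom_spans\<close> resolves. At the
  point k, \<open>g\<close> is determined by its values at the three products
  \<open>e k * param t k\<close>.\<close>

lemma tangent_hom_spans:
  assumes g: "hom_mod (fat_points n) g"
  shows "\<exists>p. \<forall>r\<in>fat_points n. g r - (\<Sum>s\<in>tangent_indices. const_A3 (p s) * tangent_hom s r) \<in> fat_points n"
proof -
  have g_add: "g (a + b) - (g a + g b) \<in> fat_points n"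
    and g_mult: "g (r * a) - r * g a \<in> fat_points n"
    if "a \<in> fat_points n" "b \<in> fat_points n" for a b r
    using g that by (auto simp: hom_mod_def)
  have "hom_mod fat_ideal (\<lambda>m. g (cutoff * m))"
    unfolding hom_mod_def
  proof (intro conjI ballI allI)
    fix a b assume "a \<in> fat_ideal" "b \<in> fat_ideal"
    then show "g (cutoff * (a + b)) - (g (cutoff * a) + g (cutoff * b)) \<in> fat_ideal"
      using g_add[OF cutoff_mult cutoff_mult, of a b] unfolding fat_points_iff by (simp add: distrib_left)
  next
    fix r a assume "a \<in> fat_ideal"
    then show "g (cutoff * (r * a)) - r * g (cutoff * a) \<in> fat_ideal"
      using g_mult[OF cutoff_mult cutoff_mult, of a a r] unfolding fat_points_iff by (simp add: mult.left_commute)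
  qed
  from loc_hom_spans[OF this] obtain p where
    p: "m \<in> fat_ideal \<Longrightarrow> g (cutoff * m) - (\<Sum>s\<in>loc_index. const_A3 (p s) * loc_hom s m) \<in> fat_ideal" for m
    by blast
  define p' where "p' = case_sum p (\<lambda>(k, t). point_eval k (g (e k * param t k)))"
  have "g r - (\<Sum>s\<in>tangent_indices. const_A3 (p' s) * tangent_hom s r) \<in> fat_points n"
    if r: "r \<in> fat_points n" for r
    unfolding fat_points_iff
  proof (intro conjI ballI)
    have rf: "r \<in> fat_ideal" using r by (simp add: fat_points_iff)
    \<comment> \<open>As \<open>cutoff\<close> is 1 modulo \<open>fat_ideal\<close>, composing with
      it does not change \<open>g r\<close> there.\<close>
    have 1: "g (cutoff * r) - cutoff * g r \<in> fat_ideal" using g_mult[OF r r] by (simp add: fat_points_iff)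
    have 2: "(\<Sum>s\<in>tangent_indices. const_A3 (p' s) * tangent_hom s r) -
        (\<Sum>s\<in>loc_index. const_A3 (p s) * loc_hom s r) \<in> fat_ideal"
      using tangent_comb_mod_fat[of p' r] by (simp add: p'_def)
    from ideal_diff[OF ideal_fat ideal_diff[OF ideal_fat ideal_diff[OF ideal_fat p[OF rf] 1]
        cutoff_cong_diff[of "g r"]] 2]
    show "g r - (\<Sum>s\<in>tangent_indices. const_A3 (p' s) * tangent_hom s r) \<in> fat_ideal"
      by (simp add: algebra_simps)
  next
    fix k assume k: "k \<in> {1..n}"
    have "point_eval k r = 0" using r k by (simp add: fat_points_iff)
    then obtain A where A: "r = (\<Sum>t<3. param t k * A t)" by (rule pt_zero_decomp)
    have pt_g_add: "point_eval k (g (a + b)) = point_eval k (g a) + point_eval k (g b)"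
      if "a \<in> fat_points n" "b \<in> fat_points n" for a b
      using g_add[OF that] k by (auto simp: fat_points_iff)
    have pt_g_mult: "point_eval k (g (c * a)) = point_eval k c * point_eval k (g a)" if "a \<in> fat_points n" for a c
      using g_mult[OF that that] k by (auto simp: fat_points_iff)
    have der: "der t k r = point_eval k (A t)" if t: "t < 3" for t
    proof -
      have "der t k r = (\<Sum>t'<3. if t = t' then point_eval k (A t') else 0)"
        unfolding A using t by (simp add: numeral_3_eq_3 der_add der_mult pt_param der_param)
      with t show ?thesis by simp
    qed
    \<comment> \<open>Since \<open>e k\<close> has value 1 at the point, \<open>r\<close> may be
      replaced by \<open>e k * r\<close>, whose summands \<open>e k * param t k\<close> lie in the
      ideal, unlike \<open>param t k\<close> in general.\<close>
    have "point_eval k (g r) = point_eval k (g (e k * r))" using pt_g_mult[OF r, of "e k"] pt_e k by simp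
    also have "e k * r = A 0 * (e k * param 0 k) + (A 1 * (e k * param 1 k) + A 2 * (e k * param 2 k))"
      unfolding A by (simp add: numeral_3_eq_3 numeral_2_eq_2 algebra_simps)
    also have "point_eval k (g \<dots>) = point_eval k (A 0) * point_eval k (g (e k * param 0 k)) +
        (point_eval k (A 1) * point_eval k (g (e k * param 1 k)) + point_eval k (A 2) * point_eval k (g (e k * param 2 k)))"
      using param_e[OF k]
      by (simp add: pt_g_add pt_g_mult ideal_add[OF ideal_fat_points] ideal_mult[OF ideal_fat_points])
    also have "\<dots> = (\<Sum>t<3. point_eval k (A t) * point_eval k (g (e k * param t k)))"
      by (simp add: numeral_3_eq_3 numeral_2_eq_2 add_ac)
    finally show "point_eval k (g r - (\<Sum>s\<in>tangent_indices. const_A3 (p' s) * tangent_hom s r)) = 0"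
      unfolding point_eval_simps pt_tangent_comb[OF k] by (simp add: der p'_def mult.commute)
  qed
  then show ?thesis by blast
qed

text \<open>Testing on \<open>cutoff * m\<close> reduces the first kind of coefficients to
  \<open>loc_hom_independent\<close>; testing on \<open>e k * param t k\<close> isolates each of the
  others.\<close>

lemma tangent_hom_independent:
  assumes comb: "\<And>r. r \<in> fat_points n \<Longrightarrow> (\<Sum>s\<in>tangent_indices. const_A3 (p s) * tangent_hom s r) \<in> fat_points n"
    and s: "s \<in> tangent_indices"
  shows "p s = 0"
proof -
  have "p (Inl s') = 0" if "s' \<in> loc_index" for s'
  proof (rule loc_hom_independent[OF _ that, where p = "\<lambda>s. p (Inl s)"])
    fix m assume m: "m \<in> fat_ideal"
    let ?H = "\<lambda>m. \<Sum>s\<in>loc_index. const_A3 (p (Inl s)) * loc_hom s m"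
    have H: "hom_mod fat_ideal ?H"
      by (intro hom_mod_sum hom_mod_mult hom_mod_loc_hom ideal_fat)
    have "?H (cutoff * m) - cutoff * ?H m \<in> fat_ideal" using H m by (simp add: hom_mod_def)
    moreover have "?H (cutoff * m) \<in> fat_ideal"
    proof -
      have "(\<Sum>s\<in>tangent_indices. const_A3 (p s) * tangent_hom s (cutoff * m)) \<in> fat_ideal"
        using comb[OF cutoff_mult[OF m]] by (simp add: fat_points_iff)
      from ideal_diff[OF ideal_fat this tangent_comb_mod_fat[of p "cutoff * m"]] show ?thesis by simp
    qed
    ultimately have "cutoff * ?H m \<in> fat_ideal" using ideal_diff[OF ideal_fat] by fastforce
    then show "?H m \<in> fat_ideal" by (simp add: cutoff_cong)
  qed
  moreover have "p (Inr (k, t)) = 0" if k: "k \<in> {1..n}" and t: "t < 3" for k t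
  proof -
    have "point_eval k (\<Sum>s\<in>tangent_indices. const_A3 (p s) * tangent_hom s (e k * param t k)) = 0"
      using comb[OF param_e[OF k t]] k by (simp add: fat_points_iff del: point_eval_sum)
    then have "(\<Sum>t'<3. p (Inr (k, t')) * der t' k (e k * param t k)) = 0"
      unfolding pt_tangent_comb[OF k] .
    \<comment> \<open>At the point k the gradient of \<open>e k * param t k\<close> is the unit
      vector with index \<open>t\<close>.\<close>
    moreover have "(\<Sum>t'<3. p (Inr (k, t')) * der t' k (e k * param t k)) =
        (\<Sum>t'<3. if t' = t then p (Inr (k, t')) else 0)"
      using k t by (intro sum.cong) (auto simp: der_mult pt_param der_param pt_e)
    ultimately show ?thesis using t by simp
  qed
  ultimately show ?thesis using s by (auto simp: tangent_indices_def)
qed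

lemma tangent_dim:
  "vectorspace.fin_dim complex_field (tangent_space_Hilb_A3 (fat_points n)) \<and>
   vectorspace.dim complex_field (tangent_space_Hilb_A3 (fat_points n)) = 45 + 3 * n"
proof -
  have "vectorspace.fin_dim complex_field (tangent_space_Hilb_A3 (fat_points n)) \<and>
      vectorspace.dim complex_field (tangent_space_Hilb_A3 (fat_points n)) = card tangent_indices"
  proof (rule dim_tangent_space_Hilb_A3[where D = tangent_hom])
    show "finite tangent_indices" by (simp add: tangent_indices_def finite_loc_index)
  qed (fact ideal_fat_points hom_mod_tangent_hom tangent_hom_spans tangent_hom_independent)+
  then show ?thesis unfolding card_tangent_indices .
qed

end

theorem corollary3p2:
  fixes d :: nat
  assumes "d \<ge> 12"
  shows "\<exists>I \<in> Hilb_A3 d.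
    vectorspace.fin_dim complex_field (tangent_space_Hilb_A3 I) \<and>
    vectorspace.dim complex_field (tangent_space_Hilb_A3 I) mod 2 \<noteq> d mod 2"
proof
  define n where "n = d - 12"
  have d: "d = 12 + n" using assms by (simp add: n_def)
  obtain e where e: "\<forall>k\<in>{1..n}. (\<exists>g. e k = mon 1 2 0 0 * g) \<and>
      (\<forall>l\<in>{1..n}. point_eval l (e k) = (if l = k then 1 else 0))"
    using separating_elements by blast
  note dims = quotient_dim[of n e] tangent_dim[of n e]
  show "fat_points n \<in> Hilb_A3 d"
    using dims(1) e by (simp add: Hilb_A3_def ideal_fat_points d)
  \<comment> \<open>The difference to d = 12 + n is 33 + 2n, which is odd.\<close>
  have "(45 + 3 * n) mod 2 \<noteq> d mod 2" unfolding d by presburger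
  then show "vectorspace.fin_dim complex_field (tangent_space_Hilb_A3 (fat_points n)) \<and>
      vectorspace.dim complex_field (tangent_space_Hilb_A3 (fat_points n)) mod 2 \<noteq> d mod 2"
    using dims(2) e by simp
qed

end
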